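(* Let $\{\boldsymbol Z_n\}_{n\ge0}$ be an irreducible multitype Galton--Watson branching process with countable typeset $\mathcal X$. If $\sup_{x\in\mathcal X}\tilde q_x<1$, then $\tilde{\boldsymbol q}=\boldsymbol q$ and $S=\{\boldsymbol q,\boldsymbol 1\}$.
   Context: A multitype Galton--Watson branching process $\{\boldsymbol Z_n\}_{n\ge0}$ with countable (finite or countably infinite) typeset $\mathcal X$: $\boldsymbol Z_n=(Z_{n,x})_{x\in\mathcal X}$, where $Z_{n,x}$ is the number of type-$x$ individuals in generation $n$. Each individual lives for one generation and at death, independently of all others, gives birth to a finite random number of offspring; a type-$x$ individual has $j_y$ children of type $y$ for all $y\in\mathcal X$ with probability $p_{x\boldsymbol j}$, $\boldsymbol j=(j_y)_{y\in\mathcal X}$, $|\boldsymbol j|:=\sum_y j_y<\infty$. The progeny generating function is $\boldsymbol G(\boldsymbol s)=(G_x(\boldsymbol s))_{x\in\mathcal X}$, $G_x(\boldsymbol s)=\sum_{\boldsymbol j:|\boldsymbol j|<\infty}p_{x\boldsymbol j}\prod_{y}s_y^{j_y}$, $\boldsymbol s\in[0,1]^{\mathcal X}$, and $S=\{\boldsymbol s\in[0,1]^{\mathcal X}:\boldsymbol s=\boldsymbol G(\boldsymbol s)\}$ is its set of fixed points. $\mathbb P_x$ and $\mathbb E_x$ denote the law of, and expectation for, the process started from a single type-$x$ individual. For $A\subseteq\mathcal X$, $\mathcal E(A)$ is the event $\lim_{n\to\infty}\sum_{x\in A}Z_{n,x}=0$; $\boldsymbol q=(q_x)_{x\in\mathcal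 X}$ with $q_x=\mathbb P_x(\mathcal E(\mathcal X))$ (global extinction); $\tilde{\boldsymbol q}=(\tilde q_x)_{x\in\mathcal X}$ with $\tilde q_x=\mathbb P_x\big(\bigcap_{A:|A|<\infty}\mathcal E(A)\big)$ (partial extinction); $\boldsymbol 1$ is the all-ones vector. Let $m_{xy}=\mathbb E_x[Z_{1,y}]$ and consider the directed graph on $\mathcal X$ with an edge $(x,y)$ iff $m_{xy}>0$. The process is irreducible if for all $x,y\in\mathcal X$ there is a path (possibly of length zero) from $x$ to $y$ in this graph.
   Formalization: The conclusion S={q,1} is claimed only if some type has a number of children different from 1 with positive probability; otherwise every constant vector in [0,1] is a fixed point (e.g. one type, exactly one child) and the claim fails. The conclusion q̃=q is unconditional. *)

theory Defs
  imports "HOL-Probability.Probability" "HOL-Library.Multiset"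
begin

text \<open>
  The typeset is the universe of a countable type. A finite offspring vector
  \<open>(j\<^sub>y)\<^sub>y\<close> is a multiset \<open>j\<close> of types, with \<open>j\<^sub>y = count j y\<close> and \<open>|j| = size j\<close>, so a
  process is given by one distribution \<open>p x\<close> on finite multisets for each type \<open>x\<close>.
\<close>

type_synonym 'a offspring = "'a \<Rightarrow> 'a multiset pmf"

text \<open>
  The coordinate \<open>\<omega> (n, x, i)\<close> is the litter of the \<open>i\<close>-th type-\<open>x\<close> individual of
  generation \<open>n\<close>; all litters are independent. The initial type is a parameter of the
  population \<open>Z\<close>, not of the measure, so the law under \<open>P\<^sub>x\<close> is that of \<open>Z x\<close> under this
  measure.
\<close>

definition GW :: "('a::countable) offspring \<Rightarrow> (nat \<times> 'a \<times> nat \<Rightarrow> 'a multiset) measure" where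
  "GW p = (\<Pi>\<^sub>M (n, x, i) \<in> UNIV. measure_pmf (p x))"

primrec Z :: "'a \<Rightarrow> nat \<Rightarrow> (nat \<times> 'a \<times> nat \<Rightarrow> 'a multiset) \<Rightarrow> 'a multiset" where
  "Z x 0 \<omega> = {#x#}"
| "Z x (Suc n) \<omega> = (\<Sum>y\<in>set_mset (Z x n \<omega>). \<Sum>i<count (Z x n \<omega>) y. \<omega> (n, y, i))"

definition extinction :: "('a::countable) offspring \<Rightarrow> 'a \<Rightarrow> 'a set
    \<Rightarrow> (nat \<times> 'a \<times> nat \<Rightarrow> 'a multiset) set" where
  "extinction p x A =
    {\<omega> \<in> space (GW p). (\<lambda>n. size {#y \<in># Z x n \<omega>. y \<in> A#}) \<longlonglongrightarrow> 0}"

definition global_extinction_prob :: "('a::countable) offspring \<Rightarrow> 'a \<Rightarrow> real" where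
  "global_extinction_prob p x = measure (GW p) (extinction p x UNIV)"

definition partial_extinction_prob :: "('a::countable) offspring \<Rightarrow> 'a \<Rightarrow> real" where
  "partial_extinction_prob p x = measure (GW p) (\<Inter>A\<in>{A. finite A}. extinction p x A)"

definition gen_fun :: "('a::countable) offspring \<Rightarrow> ('a \<Rightarrow> real) \<Rightarrow> 'a \<Rightarrow> real" where
  "gen_fun p s x = (\<Sum>\<^sub>\<infinity>j. pmf (p x) j * (\<Prod>y\<in>set_mset j. s y ^ count j y))"

definition fixed_points :: "('a::countable) offspring \<Rightarrow> ('a \<Rightarrow> real) set" where
  "fixed_points p = {s \<in> UNIV \<rightarrow> {0..1}. s = gen_fun p s}"

text \<open>Means are extended nonnegative reals, as they may be infinite.\<close>

definition mean :: "('a::countable) offspring \<Rightarrow> 'a \<Rightarrow> 'a \<Rightarrow> ennreal" where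
  "mean p x y = (\<integral>\<^sup>+ \<omega>. of_nat (count (Z x 1 \<omega>) y) \<partial>GW p)"

definition irreducible_process :: "('a::countable) offspring \<Rightarrow> bool" where
  "irreducible_process p \<longleftrightarrow> (\<forall>x y. (x, y) \<in> {(u, v). mean p u v > 0}\<^sup>*)"

text \<open>
  Excludes the degenerate case in which every individual almost surely has exactly one
  child, so that the process is a single Markovian walker. There every constant
  vector with entry in \<open>[0,1]\<close> is a fixed point, whatever the extinction probabilities are.
\<close>

definition nonsingular :: "('a::countable) offspring \<Rightarrow> bool" where
  "nonsingular p \<longleftrightarrow> (\<exists>x. measure_pmf.prob (p x) {j. size j = 1} < 1)"

end

theory Submission
  imports Defs
begin

text \<open>
  For a fixed point \<open>s\<close> of the progeny generating function, \<open>M\<^sub>n = (\<Prod>y. s\<^sub>y ^ Z\<^sub>n\<^sub>,\<^sub>y)\<close> is a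
  \<open>[0,1]\<close>-valued martingale with mean \<open>s\<^sub>x\<close> under \<open>P\<^sub>x\<close>.

  For \<open>s\<close> the vector of partial extinction probabilities, \<open>M\<^sub>n\<close> is the conditional probability of
  partial extinction given the first \<open>n\<close> generations. It is at most the supremum \<open>c < 1\<close> while the
  population is not empty; approximating the event of partial extinction by events of the past then
  shows that partial extinction without global extinction has probability zero.

  Let now \<open>s \<noteq> 1\<close> be any fixed point. By irreducibility and nonsingularity, every type \<open>y\<close> with
  \<open>s\<^sub>y > 0\<close> has some \<open>k\<close> for which \<open>M\<^sub>k\<close> is not deterministic under \<open>P\<^sub>y\<close>, so that each generation
  with \<open>y\<close> present and \<open>M\<^sub>n > e\<close> increases the bounded second moment of \<open>M\<close> by a fixed amount.
  By Borel--Cantelli, every type that occurs infinitely often forces \<open>M\<^sub>n \<le> e\<close> for some \<open>n\<close>. Hence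
  the event that \<open>M\<close> never falls to \<open>e\<close> or below is contained in partial extinction, and optional
  stopping gives \<open>s\<^sub>x \<le> e + P\<^sub>x(partial extinction)\<close>. Together with \<open>q \<le> s\<close> this leaves only \<open>s = q\<close>.
\<close>

section \<open>Finite multisets of types and their monomials\<close>

text \<open>Each multiset is coded by a list chosen to enumerate it. Countability makes every map
  into populations measurable once its fibres are, and allows conditioning on the value of
  \<open>Z x n\<close>.\<close>

instance multiset :: (countable) countable
proof
  obtain f :: "'a list \<Rightarrow> nat" where "inj f" by (metis ex_inj)
  have "inj (\<lambda>M :: 'a multiset. SOME xs. mset xs = M)"
    by (rule inj_on_inverseI[where g = mset]) (rule someI_ex[OF ex_mset])
  from inj_compose[OF \<open>inj f\<close> this] show "\<exists>g :: 'a multiset \<Rightarrow> nat. inj g" by blast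
qed

text \<open>The monomial \<open>\<Prod>y. u y ^ count z y\<close>, the integrand of the generating
  function. The form by \<open>prod_mset\<close> admits induction on the multiset.\<close>

abbreviation weight :: "('a \<Rightarrow> real) \<Rightarrow> 'a multiset \<Rightarrow> real" where
  "weight u z \<equiv> prod_mset (image_mset u z)"

lemma weight_nonneg: "(\<And>y. y \<in># z \<Longrightarrow> 0 \<le> u y) \<Longrightarrow> 0 \<le> weight u z"
  by (induction z) auto

lemma weight_mono:
  "(\<And>y. y \<in># z \<Longrightarrow> 0 \<le> u y) \<Longrightarrow> (\<And>y. y \<in># z \<Longrightarrow> u y \<le> v y) \<Longrightarrow> weight u z \<le> weight v z"
proof (induction z)
  case (add y z)
  have "0 \<le> weight u z" using add.prems(1) by (auto intro!: weight_nonneg)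
  moreover have "0 \<le> u y" "u y \<le> v y" "weight u z \<le> weight v z" using add by auto
  ultimately show ?case by (auto intro!: mult_mono)
qed auto

lemma weight_one [simp]: "weight (\<lambda>_. 1) z = 1"
  by (induction z) auto

lemma weight_const: "weight (\<lambda>_. c) z = c ^ size z"
  by (induction z) auto

lemma weight_le_1: "u \<in> UNIV \<rightarrow> {0..1} \<Longrightarrow> weight u z \<le> 1"
  using weight_mono[where u = u and z = z and v = "\<lambda>_. 1"] by (auto simp: Pi_iff)

lemma weight_bounds: "u \<in> UNIV \<rightarrow> {0..1} \<Longrightarrow> weight u z \<in> {0..1}"
  using weight_le_1[of u z] weight_nonneg[of z u] by (auto simp: Pi_iff)

lemma weight_le_member:
  assumes "u \<in> UNIV \<rightarrow> {0..1}" "y \<in># z"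
  shows "weight u z \<le> u y"
proof -
  obtain r where "z = add_mset y r" using assms(2) by (metis mset_add)
  then show ?thesis
    using weight_le_1[OF assms(1), of r] assms(1) by (auto simp: Pi_iff mult_left_le)
qed

lemma weight_power: "weight (\<lambda>y. u y ^ k) z = weight u z ^ k"
  by (induction z) (auto simp: power_mult_distrib)

lemma weight_sum: "finite A \<Longrightarrow> weight u (\<Sum>i\<in>A. f i) = (\<Prod>i\<in>A. weight u (f i))"
  by (induction A rule: finite_induct) auto

text \<open>Avoidance of a set of types is itself a monomial with entries 0 and 1, so it can be
  absorbed into the vector of a branching event.\<close>

lemma weight_indicator: "weight (\<lambda>y. of_bool (y \<notin> A)) z = of_bool (set_mset z \<inter> A = {})"
  by (induction z) auto

lemma weight_mult: "weight (\<lambda>y. u y * v y) z = weight u z * weight v z"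
  by (induction z) auto

lemma weight_tendsto:
  "(\<And>y. (\<lambda>k. u k y) \<longlonglongrightarrow> v y) \<Longrightarrow> (\<lambda>k. weight (u k) z) \<longlonglongrightarrow> weight v z"
  by (induction z) (auto intro: tendsto_mult)

lemma measurable_multiset_sum:
  fixes f :: "'i \<Rightarrow> 'b \<Rightarrow> ('a::countable) multiset"
  assumes "finite A" "\<And>i. i \<in> A \<Longrightarrow> f i \<in> M \<rightarrow>\<^sub>M count_space UNIV"
  shows "(\<lambda>\<omega>. \<Sum>i\<in>A. f i \<omega>) \<in> M \<rightarrow>\<^sub>M count_space UNIV"
  using assms
proof (induction A rule: finite_induct)
  case (insert i A)
  have 1: "f i \<in> M \<rightarrow>\<^sub>M count_space UNIV" "(\<lambda>\<omega>. \<Sum>i\<in>A. f i \<omega>) \<in> M \<rightarrow>\<^sub>M count_space UNIV"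
    using insert by auto
  have "(\<lambda>\<omega>. f i \<omega> + (\<Sum>i\<in>A. f i \<omega>)) \<in> M \<rightarrow>\<^sub>M count_space UNIV"
    by (rule measurable_compose_countable[OF _ 1(1), where f = "\<lambda>z \<omega>. z + (\<Sum>i\<in>A. f i \<omega>)"])
      (rule measurable_compose[OF 1(2)], simp)
  with insert show ?case by simp
qed simp

text \<open>Replaces conditioning on a random variable with countably many values: equality on each
  fibre gives equality on the fibres with code below \<open>k\<close>, and dominated convergence
  lets \<open>k\<close> tend to infinity.\<close>

lemma (in finite_measure) integral_eq_by_values:
  fixes f g :: "'a \<Rightarrow> real" and Y :: "'a \<Rightarrow> 'b::countable"
  assumes int: "integrable M f" "integrable M g" and Y: "Y \<in> M \<rightarrow>\<^sub>M count_space UNIV"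
    and eq: "\<And>z. (\<integral>\<omega>. of_bool (Y \<omega> = z) * f \<omega> \<partial>M) = (\<integral>\<omega>. of_bool (Y \<omega> = z) * g \<omega> \<partial>M)"
  shows "(\<integral>\<omega>. f \<omega> \<partial>M) = (\<integral>\<omega>. g \<omega> \<partial>M)"
proof -
  define h where "h k \<omega> = (\<Sum>i<k. of_bool (to_nat (Y \<omega>) = i) :: real)" for k \<omega>
  have h: "h k \<omega> = of_bool (to_nat (Y \<omega>) < k)" for k \<omega>
    unfolding h_def of_bool_def using sum.delta'[of "{..<k}" "to_nat (Y \<omega>)" "\<lambda>_. 1 :: real"] by simp
  have lim: "(\<lambda>k. \<integral>\<omega>. h k \<omega> * f \<omega> \<partial>M) \<longlonglongrightarrow> (\<integral>\<omega>. f \<omega> \<partial>M)" if "integrable M f" for f :: "'a \<Rightarrow> real"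
  proof (rule integral_dominated_convergence[where w = "\<lambda>\<omega>. \<bar>f \<omega>\<bar>"])
    have "eventually (\<lambda>k. h k \<omega> * f \<omega> = f \<omega>) sequentially" for \<omega>
      using eventually_gt_at_top[of "to_nat (Y \<omega>)"] by eventually_elim (simp add: h)
    then show "AE \<omega> in M. (\<lambda>k. h k \<omega> * f \<omega>) \<longlonglongrightarrow> f \<omega>"
      by (intro AE_I2 tendsto_eventually) auto
    have [measurable]: "f \<in> borel_measurable M" using that by auto
    have "{\<omega> \<in> space M. to_nat (Y \<omega>) < k} \<in> sets M" for k
      using measurable_sets[OF Y, of "{z. to_nat z < k}"] by (auto simp: vimage_def Int_def conj_commute)
    then show "(\<lambda>\<omega>. h k \<omega> * f \<omega>) \<in> borel_measurable M" for k
      unfolding h by measurable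
  qed (use that in \<open>auto simp: h\<close>)
  have "(\<integral>\<omega>. h k \<omega> * f \<omega> \<partial>M) = (\<integral>\<omega>. h k \<omega> * g \<omega> \<partial>M)" for k
  proof -
    \<comment> \<open>A code \<open>i\<close> outside the range of \<open>to_nat\<close> labels no
      fibre, and both integrals are zero.\<close>
    have eq': "(\<integral>\<omega>. of_bool (to_nat (Y \<omega>) = i) * f \<omega> \<partial>M) = (\<integral>\<omega>. of_bool (to_nat (Y \<omega>) = i) * g \<omega> \<partial>M)" for i
    proof (cases "\<exists>z :: 'b. to_nat z = i")
      case True
      then show ?thesis using eq by auto
    qed auto
    have int': "integrable M (\<lambda>\<omega>. of_bool (to_nat (Y \<omega>) = i) * f \<omega>)" if "integrable M f"
      for i and f :: "'a \<Rightarrow> real"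
    proof (rule Bochner_Integration.integrable_bound[OF that])
      have "{\<omega> \<in> space M. to_nat (Y \<omega>) = i} \<in> sets M"
        using measurable_sets[OF Y, of "{z. to_nat z = i}"] by (auto simp: vimage_def Int_def conj_commute)
      then show "(\<lambda>\<omega>. of_bool (to_nat (Y \<omega>) = i) * f \<omega>) \<in> borel_measurable M"
        using that by measurable
    qed auto
    show ?thesis
      unfolding h_def sum_distrib_right
        Bochner_Integration.integral_sum[OF int'[OF int(1)]] Bochner_Integration.integral_sum[OF int'[OF int(2)]]
      using eq' by simp
  qed
  with lim[OF int(1)] have "(\<lambda>k. \<integral>\<omega>. h k \<omega> * g \<omega> \<partial>M) \<longlonglongrightarrow> (\<integral>\<omega>. f \<omega> \<partial>M)" by simp
  then show ?thesis by (rule LIMSEQ_unique) (rule lim[OF int(2)])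
qed

section \<open>Filtration, branching events and local extinction\<close>

abbreviation litter :: "'a offspring \<Rightarrow> nat \<times> 'a \<times> nat \<Rightarrow> 'a multiset measure" where
  "litter p \<equiv> (\<lambda>(n, x, i). measure_pmf (p x))"

text \<open>The natural filtration, pulled back along restriction to the litters of generations
  before \<open>n\<close>. Only its measurable sets matter; restriction to a coordinate set is the
  form in which independence of disjoint coordinates is applied.\<close>

definition past :: "'a offspring \<Rightarrow> nat \<Rightarrow> (nat \<times> 'a \<times> nat \<Rightarrow> 'a multiset) measure" where
  "past p n =
    vimage_algebra UNIV (\<lambda>\<omega>. restrict \<omega> {(m, y, i). m < n}) (PiM {(m, y, i). m < n} (litter p))"

text \<open>
  The branching property for an event of the future \<open>\<phi>\<close> that occurs for the whole population iff
  it occurs for the progeny of each individual. Since \<open>Z\<close> does not record genealogies, the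
  events for single progenies cannot be named; only their probabilities are used.
\<close>
definition branching ::
    "('a::countable) offspring \<Rightarrow> ((nat \<Rightarrow> 'a multiset) \<Rightarrow> bool) \<Rightarrow> bool" where
  "branching p \<phi> \<longleftrightarrow>
    (\<forall>x n. {\<omega>. \<phi> (\<lambda>m. Z x (n + m) \<omega>)} \<in> sets (GW p)) \<and>
    (\<forall>x n. \<forall>B\<in>sets (past p n). measure (GW p) (B \<inter> {\<omega>. \<phi> (\<lambda>m. Z x (n + m) \<omega>)}) =
      (\<integral>\<omega>. indicator B \<omega> * weight (\<lambda>y. measure (GW p) {\<omega>. \<phi> (\<lambda>m. Z y m \<omega>)}) (Z x n \<omega>) \<partial>GW p))"

text \<open>Partial extinction as a property of a path. Single types suffice, because finitely many
  eventual statements hold eventually together.\<close>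

definition locally_extinct :: "(nat \<Rightarrow> 'a multiset) \<Rightarrow> bool" where
  "locally_extinct f \<longleftrightarrow> (\<forall>y. \<forall>\<^sub>F m in sequentially. y \<notin># f m)"


context
  fixes p :: "('a::countable) offspring"
begin

section \<open>Measurability of populations with respect to the past\<close>

lemma product_prob_space_litter: "product_prob_space (litter p)"
  by (rule product_prob_spaceI) (auto simp: measure_pmf.prob_space_axioms)

interpretation L: product_prob_space "litter p" UNIV
  by (rule product_prob_space_litter)

lemma prob_space_GW: "prob_space (GW p)"
  unfolding GW_def by unfold_locales

interpretation GW: prob_space "GW p"
  by (rule prob_space_GW)

lemma space_GW [simp]: "space (GW p) = UNIV"
  by (auto simp: GW_def space_PiM PiE_def split: prod.splits)

lemma space_past [simp]: "space (past p n) = UNIV"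
  by (simp add: past_def)

lemma restrict_measurable_past:
  "(\<lambda>\<omega>. restrict \<omega> {(m, y, i). m < n}) \<in> past p n \<rightarrow>\<^sub>M PiM {(m, y, i). m < n} (litter p)"
  unfolding past_def by (rule measurable_vimage_algebra1) (auto simp: space_PiM split: prod.splits)

lemma coordinate_measurable_GW [measurable]: "(\<lambda>\<omega>. \<omega> (m, y, i)) \<in> GW p \<rightarrow>\<^sub>M count_space UNIV"
  unfolding GW_def
  using measurable_component_singleton[of "(m, y, i)" UNIV "litter p"] by simp

lemma coordinate_measurable_past:
  assumes "m < n" shows "(\<lambda>\<omega>. \<omega> (m, y, i)) \<in> past p n \<rightarrow>\<^sub>M count_space UNIV"
  using measurable_compose[OF restrict_measurable_past[of n]
      measurable_component_singleton[of "(m, y, i)" _ "litter p"]] assms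
  by simp

text \<open>Common source of the inclusions between sigma-algebras: taking \<open>M\<close> to be
  \<open>GW p\<close> or a later past turns measurability of coordinates into inclusion of
  \<open>past p n\<close>.\<close>

lemma id_measurable_past:
  assumes "(\<And>m y i. m < n \<Longrightarrow> (\<lambda>\<omega>. \<omega> (m, y, i)) \<in> M \<rightarrow>\<^sub>M count_space UNIV)" "space M = UNIV"
  shows "(\<lambda>\<omega>. \<omega>) \<in> M \<rightarrow>\<^sub>M past p n"
  unfolding past_def
proof (rule measurable_vimage_algebra2)
  show "(\<lambda>\<omega>. restrict \<omega> {(m, y, i). m < n}) \<in> M \<rightarrow>\<^sub>M PiM {(m, y, i). m < n} (litter p)"
    by (rule measurable_restrict) (use assms in auto)
qed auto

lemma sets_past_GW: "A \<in> sets (past p n) \<Longrightarrow> A \<in> sets (GW p)"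
  using measurable_sets[OF id_measurable_past[OF coordinate_measurable_GW], of A n] by simp

lemma sets_past_mono: "n \<le> n' \<Longrightarrow> A \<in> sets (past p n) \<Longrightarrow> A \<in> sets (past p n')"
  using measurable_sets[OF id_measurable_past[of n "past p n'"], of A] coordinate_measurable_past by simp

text \<open>Once the value of generation \<open>n\<close> is fixed, the next generation is a finite
  sum of litter coordinates; there are countably many such values.\<close>

lemma Z_measurable_past: "Z x n \<in> past p n \<rightarrow>\<^sub>M count_space UNIV"
proof (induction n)
  case (Suc n)
  have *: "Z x n \<in> past p (Suc n) \<rightarrow>\<^sub>M count_space UNIV"
    using measurable_compose[OF id_measurable_past[of n "past p (Suc n)"] Suc] coordinate_measurable_past
    by simp
  have "(\<lambda>\<omega>. \<Sum>y\<in>set_mset (Z x n \<omega>). \<Sum>i<count (Z x n \<omega>) y. \<omega> (n, y, i)) \<in> past p (Suc n) \<rightarrow>\<^sub>M count_space UNIV"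
    by (rule measurable_compose_countable[OF _ *, where f = "\<lambda>z \<omega>. \<Sum>y\<in>set_mset z. \<Sum>i<count z y. \<omega> (n, y, i)"])
      (intro measurable_multiset_sum coordinate_measurable_past; simp)
  then show ?case by simp
qed simp

lemma sets_past_Z: "{\<omega>. P (Z x n \<omega>)} \<in> sets (past p n)"
  using measurable_sets[OF Z_measurable_past[of x n], of "{z. P z}"] by (simp add: vimage_def)

lemma sets_GW_Z: "{\<omega>. P (Z x n \<omega>)} \<in> sets (GW p)"
  by (rule sets_past_GW[OF sets_past_Z])

lemma Z_measurable [measurable]: "Z x n \<in> GW p \<rightarrow>\<^sub>M count_space UNIV"
  using measurable_compose[OF id_measurable_past[OF coordinate_measurable_GW] Z_measurable_past] by simp

section \<open>Independence of litters and the one-step branching identity\<close>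

lemma integral_litter:
  fixes f :: "'a multiset \<Rightarrow> real"
  shows "(\<integral>\<omega>. f (\<omega> (n, y, i)) \<partial>GW p) = (\<integral>j. f j \<partial>measure_pmf (p y))"
proof -
  have "measure_pmf (p y) = distr (GW p) (measure_pmf (p y)) (\<lambda>\<omega>. \<omega> (n, y, i))"
    using L.PiM_component[of "(n, y, i)"] by (simp add: GW_def)
  then have "(\<integral>j. f j \<partial>measure_pmf (p y)) = (\<integral>j. f j \<partial>distr (GW p) (measure_pmf (p y)) (\<lambda>\<omega>. \<omega> (n, y, i)))"
    by simp
  also have "\<dots> = (\<integral>\<omega>. f (\<omega> (n, y, i)) \<partial>GW p)"
    by (rule integral_distr) auto
  finally show ?thesis ..
qed

text \<open>Independence means that the joint law is the product of the marginals. The joint law of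
  all coordinates is the product measure itself.\<close>

lemma indep_litters: "GW.indep_vars (litter p) (\<lambda>k \<omega>. \<omega> k) UNIV"
proof -
  have rv: "(\<lambda>\<omega>. \<omega> k) \<in> GW p \<rightarrow>\<^sub>M litter p k" for k
    unfolding GW_def by simp
  have "distr (GW p) (PiM UNIV (litter p)) (\<lambda>\<omega>. \<lambda>k\<in>UNIV. \<omega> k) = GW p"
    unfolding GW_def restrict_UNIV by (simp add: distr_id)
  also have "\<dots> = PiM UNIV (\<lambda>k. distr (GW p) (litter p k) (\<lambda>\<omega>. \<omega> k))"
    unfolding GW_def by (rule PiM_cong) (auto simp: L.PiM_component)
  finally show ?thesis
    using rv by (subst GW.indep_vars_iff_distr_eq_PiM) auto
qed

text \<open>An event of the past depends only on coordinates with \<open>m < n\<close>, the product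
  only on coordinates of generation \<open>n\<close>. These sets are disjoint, and the litters in
  \<open>I\<close> are independent of each other too. The index set is deterministic, so it is to be
  applied with the population fixed.\<close>

lemma integral_past_litters:
  fixes h :: "'a multiset \<Rightarrow> real"
  assumes B: "B \<in> sets (past p n)" and I: "finite I" and h: "\<And>j. h j \<in> {0..1}"
  shows "(\<integral>\<omega>. indicator B \<omega> * (\<Prod>(y, i)\<in>I. h (\<omega> (n, y, i))) \<partial>GW p) =
    measure (GW p) B * (\<Prod>(y, i)\<in>I. \<integral>j. h j \<partial>measure_pmf (p y))"
proof -
  let ?J = "{(m, y, i). m < n}" and ?K = "(\<lambda>(y, i). (n, y, i)) ` I"
  obtain B' where B': "B' \<in> sets (PiM ?J (litter p))" "B = (\<lambda>\<omega>. restrict \<omega> ?J) -` B'"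
    using B unfolding past_def sets_vimage_algebra2 by (subst (asm) sets_vimage_algebra2) (auto simp: space_PiM split: prod.splits)
  have K: "(\<Prod>(y, i)\<in>I. h (\<omega> (n, y, i))) = (\<Prod>k\<in>?K. h (\<omega> k))" for \<omega>
    by (subst prod.reindex) (auto simp: inj_on_def intro!: prod.cong)
  have [measurable]: "(\<lambda>\<omega>. \<omega> k) \<in> GW p \<rightarrow>\<^sub>M count_space UNIV" for k
    by (cases k) auto
  have [measurable]: "B \<in> sets (GW p)" using B by (rule sets_past_GW)
  have hm: "(\<lambda>\<omega>. h (\<omega> k)) \<in> borel_measurable (GW p)" for k by measurable
  have hi: "integrable (GW p) (\<lambda>\<omega>. \<Prod>k\<in>?K. h (\<omega> k))"
  proof (rule GW.integrable_const_bound[where B = 1])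
    show "AE \<omega> in GW p. norm (\<Prod>k\<in>?K. h (\<omega> k)) \<le> 1"
      using h by (auto simp: abs_prod intro!: prod_le_1)
  qed (use hm in measurable)
  have "GW.indep_var (PiM ?J (litter p)) (\<lambda>\<omega>. restrict \<omega> ?J) (PiM ?K (litter p)) (\<lambda>\<omega>. restrict \<omega> ?K)"
    using GW.indep_var_restrict[OF indep_litters, of ?J ?K] by auto
  then have "GW.indep_var borel (indicator B' \<circ> (\<lambda>\<omega>. restrict \<omega> ?J) :: _ \<Rightarrow> real)
      borel ((\<lambda>\<omega>. \<Prod>k\<in>?K. h (\<omega> k)) \<circ> (\<lambda>\<omega>. restrict \<omega> ?K))"
  proof (rule GW.indep_var_compose)
    show "indicator B' \<in> borel_measurable (PiM ?J (litter p))" using B' by simp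
    show "(\<lambda>\<omega>. \<Prod>k\<in>?K. h (\<omega> k)) \<in> borel_measurable (PiM ?K (litter p))"
    proof (rule borel_measurable_prod)
      fix k assume "k \<in> ?K"
      then have "(\<lambda>\<omega>. \<omega> k) \<in> PiM ?K (litter p) \<rightarrow>\<^sub>M litter p k" by (rule measurable_component_singleton)
      then show "(\<lambda>\<omega>. h (\<omega> k)) \<in> borel_measurable (PiM ?K (litter p))"
        by (rule measurable_compose) (auto split: prod.splits)
    qed
  qed
  moreover have "indicator B' \<circ> (\<lambda>\<omega>. restrict \<omega> ?J) = (indicator B :: _ \<Rightarrow> real)"
    using B' by (auto simp: fun_eq_iff indicator_def)
  moreover have "(\<lambda>\<omega>. \<Prod>k\<in>?K. h (\<omega> k)) \<circ> (\<lambda>\<omega>. restrict \<omega> ?K) = (\<lambda>\<omega>. \<Prod>k\<in>?K. h (\<omega> k))"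
    by (auto simp: fun_eq_iff intro!: prod.cong)
  ultimately have "GW.indep_var borel (indicator B) borel (\<lambda>\<omega>. \<Prod>k\<in>?K. h (\<omega> k))"
    by simp
  then have "(\<integral>\<omega>. indicator B \<omega> * (\<Prod>k\<in>?K. h (\<omega> k)) \<partial>GW p) =
      measure (GW p) B * (\<integral>\<omega>. (\<Prod>k\<in>?K. h (\<omega> k)) \<partial>GW p)"
    by (subst GW.indep_var_lebesgue_integral) (use hi in \<open>auto intro: GW.integrable_const_bound[where B = 1]\<close>)
  also have "(\<integral>\<omega>. (\<Prod>k\<in>?K. h (\<omega> k)) \<partial>GW p) = (\<Prod>k\<in>?K. \<integral>\<omega>. h (\<omega> k) \<partial>GW p)"
  proof (rule GW.indep_vars_lebesgue_integral)
    show "finite ?K" using I by simp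
    have "GW.indep_vars (litter p) (\<lambda>k \<omega>. \<omega> k) ?K"
      by (rule GW.indep_vars_subset[OF indep_litters]) simp
    then show "GW.indep_vars (\<lambda>_. borel) (\<lambda>k \<omega>. h (\<omega> k)) ?K"
      by (rule GW.indep_vars_compose2) (auto split: prod.splits)
    show "integrable (GW p) (\<lambda>\<omega>. h (\<omega> k))" for k
      by (rule GW.integrable_const_bound[where B = 1]) (use h in auto)
  qed
  also have "\<dots> = (\<Prod>(y, i)\<in>I. \<integral>j. h j \<partial>measure_pmf (p y))"
    by (subst prod.reindex) (auto simp: inj_on_def integral_litter intro!: prod.cong)
  finally show ?thesis unfolding K .
qed

text \<open>Monomials with entries in \<open>[0,1]\<close> are bounded by 1, so the series converges
  absolutely and equals the expectation over one litter.\<close>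

lemma gen_fun_eq_integral:
  assumes "u \<in> UNIV \<rightarrow> {0..1}"
  shows "gen_fun p u x = (\<integral>j. weight u j \<partial>measure_pmf (p x))"
proof -
  have "(\<integral>j. weight u j \<partial>measure_pmf (p x)) = infsetsum (\<lambda>j. pmf (p x) j * weight u j) UNIV"
    by (rule pmf_expectation_eq_infsetsum)
  also have "\<dots> = (\<Sum>\<^sub>\<infinity>j. pmf (p x) j * weight u j)"
  proof (rule infsetsum_infsum)
    have "Infinite_Set_Sum.abs_summable_on (\<lambda>j. pmf (p x) j) UNIV" by (rule pmf_abs_summable)
    then show "Infinite_Set_Sum.abs_summable_on (\<lambda>j. pmf (p x) j * weight u j) UNIV"
      by (rule abs_summable_on_comparison_test)
        (use weight_bounds[OF assms] in \<open>auto simp: abs_mult mult_left_le\<close>)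
  qed
  finally show ?thesis unfolding gen_fun_def image_prod_mset_multiplicity by simp
qed

lemma integrable_weight_pmf:
  "u \<in> UNIV \<rightarrow> {0..1} \<Longrightarrow> integrable (measure_pmf q) (weight u)"
  by (rule measure_pmf.integrable_const_bound[where B = 1]) (use weight_bounds in force)+

lemma gen_fun_bounds:
  assumes "u \<in> UNIV \<rightarrow> {0..1}" shows "gen_fun p u \<in> UNIV \<rightarrow> {0..1}"
proof
  fix x
  have "(\<integral>j. weight u j \<partial>measure_pmf (p x)) \<le> (\<integral>j. 1 \<partial>measure_pmf (p x))"
    by (rule integral_mono) (use weight_le_1[OF assms] integrable_weight_pmf[OF assms] in auto)
  moreover have "0 \<le> (\<integral>j. weight u j \<partial>measure_pmf (p x))"
    using weight_bounds[OF assms] by (intro Bochner_Integration.integral_nonneg) auto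
  ultimately show "gen_fun p u x \<in> {0..1}" by (simp add: gen_fun_eq_integral[OF assms])
qed

lemma gen_fun_mono:
  assumes "u \<in> UNIV \<rightarrow> {0..1}" "v \<in> UNIV \<rightarrow> {0..1}" "\<And>y. u y \<le> v y"
  shows "gen_fun p u x \<le> gen_fun p v x"
  unfolding gen_fun_eq_integral[OF assms(1)] gen_fun_eq_integral[OF assms(2)]
  by (rule integral_mono) (use assms integrable_weight_pmf in \<open>auto intro!: weight_mono simp: Pi_iff\<close>)

lemma integrable_weight:
  assumes "u \<in> UNIV \<rightarrow> {0..1}" "B \<in> sets (GW p)"
  shows "integrable (GW p) (\<lambda>\<omega>. indicator B \<omega> * weight u (Z x n \<omega>))"
proof (rule GW.integrable_const_bound[where B = 1])
  show "AE \<omega> in GW p. norm (indicator B \<omega> * weight u (Z x n \<omega>)) \<le> 1"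
    using weight_bounds[OF assms(1)] by (auto simp: indicator_def)
  have "(\<lambda>\<omega>. weight u (Z x n \<omega>)) \<in> borel_measurable (GW p)"
    by (rule measurable_compose[OF Z_measurable]) simp
  then show "(\<lambda>\<omega>. indicator B \<omega> * weight u (Z x n \<omega>)) \<in> borel_measurable (GW p)"
    using assms(2) by measurable
qed

lemma weight_Z_Suc:
  "weight u (Z x (Suc n) \<omega>) =
    (\<Prod>(y, i)\<in>(SIGMA y:set_mset (Z x n \<omega>). {..<count (Z x n \<omega>) y}). weight u (\<omega> (n, y, i)))"
  by (simp add: weight_sum prod.Sigma)

text \<open>Integrated form of the statement that the conditional mean of \<open>weight u\<close> at
  generation \<open>n + 1\<close>, given the past, is \<open>weight (gen_fun p u)\<close> at
  generation \<open>n\<close>. On each fibre of \<open>Z x n\<close> the parents form a fixed finite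
  index set.\<close>

lemma integral_weight_Suc:
  assumes B: "B \<in> sets (past p n)" and u: "u \<in> UNIV \<rightarrow> {0..1}"
  shows "(\<integral>\<omega>. indicator B \<omega> * weight u (Z x (Suc n) \<omega>) \<partial>GW p) =
    (\<integral>\<omega>. indicator B \<omega> * weight (gen_fun p u) (Z x n \<omega>) \<partial>GW p)"
proof (rule GW.integral_eq_by_values[where Y = "Z x n"])
  have B': "B \<in> sets (GW p)" using B by (rule sets_past_GW)
  show "integrable (GW p) (\<lambda>\<omega>. indicator B \<omega> * weight u (Z x (Suc n) \<omega>))"
    by (rule integrable_weight[OF u B'])
  show "integrable (GW p) (\<lambda>\<omega>. indicator B \<omega> * weight (gen_fun p u) (Z x n \<omega>))"
    by (rule integrable_weight[OF gen_fun_bounds[OF u] B'])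
  fix z
  let ?I = "SIGMA y:set_mset z. {..<count z y}" and ?C = "B \<inter> {\<omega>. Z x n \<omega> = z}"
  have C: "?C \<in> sets (past p n)" using B sets_past_Z[of "\<lambda>w. w = z"] by auto
  have "(\<integral>\<omega>. of_bool (Z x n \<omega> = z) * (indicator B \<omega> * weight u (Z x (Suc n) \<omega>)) \<partial>GW p) =
     (\<integral>\<omega>. indicator ?C \<omega> * (\<Prod>(y, i)\<in>?I. weight u (\<omega> (n, y, i))) \<partial>GW p)"
    by (intro Bochner_Integration.integral_cong) (auto simp: indicator_def weight_Z_Suc simp del: Z.simps)
  also have "\<dots> = measure (GW p) ?C * (\<Prod>(y, i)\<in>?I. \<integral>j. weight u j \<partial>measure_pmf (p y))"
    by (rule integral_past_litters[OF C]) (use weight_bounds[OF u] in auto)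
  also have "(\<Prod>(y, i)\<in>?I. \<integral>j. weight u j \<partial>measure_pmf (p y)) = weight (gen_fun p u) z"
    by (simp add: prod.Sigma[symmetric] gen_fun_eq_integral[OF u] image_prod_mset_multiplicity)
  also have "measure (GW p) ?C * weight (gen_fun p u) z = (\<integral>\<omega>. indicator ?C \<omega> * weight (gen_fun p u) z \<partial>GW p)"
    by simp
  also have "\<dots> = (\<integral>\<omega>. of_bool (Z x n \<omega> = z) * (indicator B \<omega> * weight (gen_fun p u) (Z x n \<omega>)) \<partial>GW p)"
    by (intro Bochner_Integration.integral_cong) (auto simp: indicator_def simp del: Z.simps)
  finally show "(\<integral>\<omega>. of_bool (Z x n \<omega> = z) * (indicator B \<omega> * weight u (Z x (Suc n) \<omega>)) \<partial>GW p) =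
    (\<integral>\<omega>. of_bool (Z x n \<omega> = z) * (indicator B \<omega> * weight (gen_fun p u) (Z x n \<omega>)) \<partial>GW p)" .
qed (rule Z_measurable)

section \<open>Closure properties of branching events\<close>

lemma branching_sets:
  assumes "branching p \<phi>" shows "{\<omega>. \<phi> (\<lambda>m. Z x (n + m) \<omega>)} \<in> sets (GW p)"
  using assms by (auto simp: branching_def)

lemma branching_prob:
  assumes "branching p \<phi>" "B \<in> sets (past p n)"
  shows "measure (GW p) (B \<inter> {\<omega>. \<phi> (\<lambda>m. Z x (n + m) \<omega>)}) =
    (\<integral>\<omega>. indicator B \<omega> * weight (\<lambda>y. measure (GW p) {\<omega>. \<phi> (\<lambda>m. Z y m \<omega>)}) (Z x n \<omega>) \<partial>GW p)"
  using assms by (auto simp: branching_def)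

lemma UNIV_past [simp]: "UNIV \<in> sets (past p n)"
  using sets.top[of "past p n"] by simp

lemma UNIV_GW [simp]: "UNIV \<in> sets (GW p)"
  using sets.top[of "GW p"] by simp

lemma prob_UNIV [simp]: "measure (GW p) UNIV = 1"
  using GW.prob_space by simp

lemma integral_mult_prob:
  assumes "B \<in> sets (GW p)" shows "(\<integral>\<omega>. indicator B \<omega> * (c::real) \<partial>GW p) = measure (GW p) B * c"
  using assms by simp

lemma branching_True: "branching p (\<lambda>_. True)"
  by (auto simp: branching_def sets_past_GW)

text \<open>Adding one generation in front multiplies by the monomial that forbids \<open>A\<close>
  and applies the generating function once. Starting from \<open>branching_True\<close>, this builds
  events over finitely many generations.\<close>

lemma branching_step:
  assumes \<phi>: "branching p \<phi>"
  shows "branching p (\<lambda>f. set_mset (f 0) \<inter> A = {} \<and> \<phi> (\<lambda>m. f (Suc m)))" (is "branching p ?\<psi>")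
proof -
  let ?u = "\<lambda>y. measure (GW p) {\<omega>. \<phi> (\<lambda>m. Z y m \<omega>)}"
  let ?v = "\<lambda>y. of_bool (y \<notin> A) * gen_fun p ?u y"
  let ?C = "\<lambda>x n. {\<omega>. set_mset (Z x n \<omega>) \<inter> A = {}}"
  have u: "?u \<in> UNIV \<rightarrow> {0..1}" by simp
  have eq: "{\<omega>. ?\<psi> (\<lambda>m. Z x (n + m) \<omega>)} = ?C x n \<inter> {\<omega>. \<phi> (\<lambda>m. Z x (Suc n + m) \<omega>)}" for x n
    by (auto simp del: Z.simps)
  have C: "?C x n \<in> sets (past p n)" for x n by (rule sets_past_Z)
  have meas: "{\<omega>. ?\<psi> (\<lambda>m. Z x (n + m) \<omega>)} \<in> sets (GW p)" for x n
    unfolding eq using sets_past_GW[OF C] branching_sets[OF \<phi>] by blast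
  have step: "measure (GW p) (B \<inter> {\<omega>. ?\<psi> (\<lambda>m. Z x (n + m) \<omega>)}) =
      (\<integral>\<omega>. indicator B \<omega> * weight ?v (Z x n \<omega>) \<partial>GW p)" if B: "B \<in> sets (past p n)" for B x n
  proof -
    have BC: "B \<inter> ?C x n \<in> sets (past p n)" using B C by blast
    have "measure (GW p) (B \<inter> {\<omega>. ?\<psi> (\<lambda>m. Z x (n + m) \<omega>)}) =
        measure (GW p) ((B \<inter> ?C x n) \<inter> {\<omega>. \<phi> (\<lambda>m. Z x (Suc n + m) \<omega>)})"
      unfolding eq by (simp add: Int_assoc)
    also have "\<dots> = (\<integral>\<omega>. indicator (B \<inter> ?C x n) \<omega> * weight ?u (Z x (Suc n) \<omega>) \<partial>GW p)"
      by (rule branching_prob[OF \<phi> sets_past_mono[OF _ BC]]) simp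
    also have "\<dots> = (\<integral>\<omega>. indicator (B \<inter> ?C x n) \<omega> * weight (gen_fun p ?u) (Z x n \<omega>) \<partial>GW p)"
      by (rule integral_weight_Suc[OF BC u])
    also have "\<dots> = (\<integral>\<omega>. indicator B \<omega> * weight ?v (Z x n \<omega>) \<partial>GW p)"
      unfolding weight_mult weight_indicator
      by (intro Bochner_Integration.integral_cong) (auto simp: indicator_def)
    finally show ?thesis .
  qed
  \<comment> \<open>At generation 0 the population is the single individual \<open>y\<close>, so the
    identity just proved shows that \<open>?v\<close> is the probability vector of the new
    event.\<close>
  have "measure (GW p) {\<omega>. ?\<psi> (\<lambda>m. Z y m \<omega>)} = ?v y" for y
    using step[of UNIV 0 y] by simp
  with step meas show ?thesis unfolding branching_def by simp
qed

text \<open>Both sides of the branching identity pass to the limit by dominated convergence; on the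
  right a monomial has only finitely many factors, so pointwise convergence of the vectors is
  enough.\<close>

lemma branching_limit:
  assumes \<phi>: "\<And>k. branching p (\<phi> k)" and lim: "\<And>f. \<forall>\<^sub>F k in sequentially. \<phi> k f = \<psi> f"
  shows "branching p \<psi>"
proof -
  let ?u = "\<lambda>k y. measure (GW p) {\<omega>. \<phi> k (\<lambda>m. Z y m \<omega>)}"
  let ?v = "\<lambda>y. measure (GW p) {\<omega>. \<psi> (\<lambda>m. Z y m \<omega>)}"
  have ind: "(\<lambda>k. indicator B \<omega> * indicator {\<omega>. \<phi> k (\<lambda>m. Z x (n + m) \<omega>)} \<omega> :: real)
      \<longlonglongrightarrow> indicator B \<omega> * indicator {\<omega>. \<psi> (\<lambda>m. Z x (n + m) \<omega>)} \<omega>" for B \<omega> x n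
    using lim[of "\<lambda>m. Z x (n + m) \<omega>"]
    by (intro tendsto_eventually) (auto elim!: eventually_mono simp: indicator_def)
  have meas: "{\<omega>. \<psi> (\<lambda>m. Z x (n + m) \<omega>)} \<in> sets (GW p)" for x n
  proof -
    have "(indicator {\<omega>. \<psi> (\<lambda>m. Z x (n + m) \<omega>)} :: _ \<Rightarrow> real) \<in> borel_measurable (GW p)"
      by (rule borel_measurable_LIMSEQ_real[OF ind[of UNIV, simplified]])
        (use branching_sets[OF \<phi>] in simp)
    then show ?thesis by (simp add: borel_measurable_indicator_iff)
  qed
  have conv: "(\<lambda>k. measure (GW p) (B \<inter> {\<omega>. \<phi> k (\<lambda>m. Z x (n + m) \<omega>)}))
      \<longlonglongrightarrow> measure (GW p) (B \<inter> {\<omega>. \<psi> (\<lambda>m. Z x (n + m) \<omega>)})" if B: "B \<in> sets (GW p)" for B x n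
  proof -
    have "(\<lambda>k. \<integral>\<omega>. indicator B \<omega> * indicator {\<omega>. \<phi> k (\<lambda>m. Z x (n + m) \<omega>)} \<omega> \<partial>GW p)
       \<longlonglongrightarrow> (\<integral>\<omega>. (indicator B \<omega> * indicator {\<omega>. \<psi> (\<lambda>m. Z x (n + m) \<omega>)} \<omega> :: real) \<partial>GW p)"
      by (rule integral_dominated_convergence[where w = "\<lambda>_. 1"])
        (use B ind meas branching_sets[OF \<phi>] in \<open>auto simp flip: indicator_inter_arith\<close>)
    then show ?thesis
      by (simp add: indicator_inter_arith[symmetric] B meas branching_sets[OF \<phi>] sets.Int)
  qed
  have u: "?u k \<in> UNIV \<rightarrow> {0..1}" for k by simp
  have v: "?v \<in> UNIV \<rightarrow> {0..1}" by simp
  have uv: "(\<lambda>k. ?u k y) \<longlonglongrightarrow> ?v y" for y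
    using conv[of UNIV y 0] by simp
  have "measure (GW p) (B \<inter> {\<omega>. \<psi> (\<lambda>m. Z x (n + m) \<omega>)}) =
      (\<integral>\<omega>. indicator B \<omega> * weight ?v (Z x n \<omega>) \<partial>GW p)" if B: "B \<in> sets (past p n)" for B x n
  proof (rule LIMSEQ_unique)
    show "(\<lambda>k. measure (GW p) (B \<inter> {\<omega>. \<phi> k (\<lambda>m. Z x (n + m) \<omega>)}))
      \<longlonglongrightarrow> measure (GW p) (B \<inter> {\<omega>. \<psi> (\<lambda>m. Z x (n + m) \<omega>)})"
      by (rule conv[OF sets_past_GW[OF B]])
    show "(\<lambda>k. measure (GW p) (B \<inter> {\<omega>. \<phi> k (\<lambda>m. Z x (n + m) \<omega>)}))
      \<longlonglongrightarrow> (\<integral>\<omega>. indicator B \<omega> * weight ?v (Z x n \<omega>) \<partial>GW p)"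
      unfolding branching_prob[OF \<phi> B]
    proof (rule integral_dominated_convergence[where w = "\<lambda>_. 1"])
      show "(\<lambda>\<omega>. indicator B \<omega> * weight ?v (Z x n \<omega>)) \<in> borel_measurable (GW p)"
        using integrable_weight[OF v sets_past_GW[OF B]] by blast
      show "(\<lambda>\<omega>. indicator B \<omega> * weight (?u k) (Z x n \<omega>)) \<in> borel_measurable (GW p)" for k
        using integrable_weight[OF u sets_past_GW[OF B]] by blast
      show "AE \<omega> in GW p. (\<lambda>k. indicator B \<omega> * weight (?u k) (Z x n \<omega>)) \<longlonglongrightarrow> indicator B \<omega> * weight ?v (Z x n \<omega>)"
        by (intro AE_I2 tendsto_mult tendsto_const weight_tendsto uv)
      show "AE \<omega> in GW p. norm (indicator B \<omega> * weight (?u k) (Z x n \<omega>)) \<le> 1" for k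
        using weight_bounds[OF u[of k]] by (auto simp: indicator_def)
    qed simp
  qed
  with meas show ?thesis unfolding branching_def by simp
qed

text \<open>Local extinction is reached by successive steps and limits: \<open>A\<close> is avoided
  for \<open>K\<close> generations, forever, from generation \<open>N\<close> on, eventually;
  finally \<open>A\<close> exhausts the types.\<close>

lemma branching_locally_extinct: "branching p locally_extinct"
proof -
  have 1: "branching p (\<lambda>f. \<forall>m<K. set_mset (f m) \<inter> A = {})" for A and K :: nat
  proof (induction K)
    case (Suc K)
    from branching_step[OF this, of A] show ?case unfolding All_less_Suc2 .
  qed (simp add: branching_True)
  have 2: "branching p (\<lambda>f. \<forall>m. set_mset (f m) \<inter> A = {})" for A
  proof (rule branching_limit[OF 1])
    fix f :: "nat \<Rightarrow> 'a multiset"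
    show "\<forall>\<^sub>F K in sequentially. (\<forall>m<K. set_mset (f m) \<inter> A = {}) = (\<forall>m. set_mset (f m) \<inter> A = {})"
    proof (cases "\<forall>m. set_mset (f m) \<inter> A = {}")
      case False
      then obtain m where "set_mset (f m) \<inter> A \<noteq> {}" by blast
      then have "(\<forall>m<K. set_mset (f m) \<inter> A = {}) = (\<forall>m. set_mset (f m) \<inter> A = {})" if "m < K" for K
        using that by blast
      then show ?thesis by (rule eventually_mono[OF eventually_gt_at_top])
    qed simp
  qed
  have 3: "branching p (\<lambda>f. \<forall>m\<ge>N. set_mset (f m) \<inter> A = {})" for A N
  proof (induction N)
    case (Suc N)
    have "(\<forall>m\<ge>N. set_mset (f (Suc m)) \<inter> A = {}) = (\<forall>m\<ge>Suc N. set_mset (f m) \<inter> A = {})" for f :: "nat \<Rightarrow> 'a multiset"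
      by (metis Suc_le_D Suc_le_mono)
    \<comment> \<open>The empty set imposes no condition on the present generation, so the step is a
      pure shift in time.\<close>
    with branching_step[OF Suc, of "{}"] show ?case by simp
  qed (simp add: 2)
  have 4: "branching p (\<lambda>f. \<exists>N. \<forall>m\<ge>N. set_mset (f m) \<inter> A = {})" for A
  proof (rule branching_limit[OF 3])
    fix f :: "nat \<Rightarrow> 'a multiset"
    show "\<forall>\<^sub>F N in sequentially. (\<forall>m\<ge>N. set_mset (f m) \<inter> A = {}) = (\<exists>N. \<forall>m\<ge>N. set_mset (f m) \<inter> A = {})"
    proof (cases "\<exists>N. \<forall>m\<ge>N. set_mset (f m) \<inter> A = {}")
      case True
      then obtain N where N: "\<forall>m\<ge>N. set_mset (f m) \<inter> A = {}" by blast
      show ?thesis using eventually_ge_at_top[of N] by eventually_elim (use N in \<open>meson order_trans\<close>)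
    next
      case False
      then show ?thesis by (intro always_eventually) blast
    qed
  qed
  \<comment> \<open>Finite sets increasing to the whole typeset. The eventual avoidance of
    \<open>?A i\<close> stabilizes in \<open>i\<close>: a type that keeps recurring is in
    \<open>?A i\<close> for all large \<open>i\<close>.\<close>
  let ?A = "\<lambda>i. {y :: 'a. to_nat y < i}"
  show ?thesis
  proof (rule branching_limit[OF 4])
    fix f :: "nat \<Rightarrow> 'a multiset"
    let ?\<phi> = "\<lambda>i. \<forall>\<^sub>F m in sequentially. set_mset (f m) \<inter> ?A i = {}"
    have "finite (?A i)" for i
      by (rule inj_on_finite[of to_nat _ "{..<i}"]) auto
    then have A: "?\<phi> i \<longleftrightarrow> (\<forall>y. to_nat y < i \<longrightarrow> (\<forall>\<^sub>F m in sequentially. y \<notin># f m))" for i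
      using eventually_ball_finite_distrib[of "?A i" "\<lambda>m y. y \<notin># f m" sequentially]
      by (auto elim!: eventually_mono simp: disjoint_iff)
    have "\<forall>\<^sub>F i in sequentially. ?\<phi> i = locally_extinct f"
    proof (cases "locally_extinct f")
      case False
      then obtain y where "\<not> (\<forall>\<^sub>F m in sequentially. y \<notin># f m)" by (auto simp: locally_extinct_def)
      then have "\<not> ?\<phi> i" if "to_nat y < i" for i using that unfolding A by blast
      then have "?\<phi> i = locally_extinct f" if "to_nat y < i" for i using that False by blast
      then show ?thesis by (rule eventually_mono[OF eventually_gt_at_top])
    qed (auto simp: A locally_extinct_def)
    then show "\<forall>\<^sub>F i in sequentially. (\<exists>N. \<forall>m\<ge>N. set_mset (f m) \<inter> ?A i = {}) = locally_extinct f"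
      by (simp add: eventually_sequentially)
  qed
qed

section \<open>Extinction as a property of paths\<close>

lemma extinction_eq: "extinction p x A = {\<omega>. \<forall>\<^sub>F n in sequentially. set_mset (Z x n \<omega>) \<inter> A = {}}"
  unfolding extinction_def tendsto_discrete by (auto simp: filter_mset_eq_mempty_iff disjoint_iff)

lemma partial_extinction_prob_eq:
  "partial_extinction_prob p x = measure (GW p) {\<omega>. locally_extinct (\<lambda>m. Z x m \<omega>)}"
proof -
  have "(\<forall>A. finite A \<longrightarrow> (\<forall>\<^sub>F n in sequentially. set_mset (Z x n \<omega>) \<inter> A = {})) \<longleftrightarrow>
      locally_extinct (\<lambda>m. Z x m \<omega>)" (is "?l \<longleftrightarrow> ?r") for \<omega>
  proof
    assume ?l
    then have "\<forall>\<^sub>F n in sequentially. set_mset (Z x n \<omega>) \<inter> {y} = {}" for y by blast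
    then show ?r by (simp add: locally_extinct_def)
  next
    assume ?r
    show ?l
    proof (intro allI impI)
      fix A :: "'a set" assume "finite A"
      then have "\<forall>\<^sub>F n in sequentially. \<forall>y\<in>A. y \<notin># Z x n \<omega>"
        using \<open>?r\<close> by (simp add: eventually_ball_finite_distrib locally_extinct_def)
      then show "\<forall>\<^sub>F n in sequentially. set_mset (Z x n \<omega>) \<inter> A = {}"
        by (rule eventually_mono) blast
    qed
  qed
  then show ?thesis
    unfolding partial_extinction_prob_def extinction_eq
    by (intro arg_cong[where f = "measure (GW p)"]) auto
qed

lemma Z_empty_mono: "Z x n \<omega> = {#} \<Longrightarrow> n \<le> m \<Longrightarrow> Z x m \<omega> = {#}"
  by (induction m) (auto simp: le_Suc_eq)

lemma global_extinction_prob_eq: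
  "global_extinction_prob p x = measure (GW p) {\<omega>. \<exists>n. Z x n \<omega> = {#}}"
  unfolding global_extinction_prob_def extinction_eq eventually_sequentially
  by (rule arg_cong[where f = "measure (GW p)"]) (auto intro: Z_empty_mono)

lemma locally_extinct_sets: "{\<omega>. locally_extinct (\<lambda>m. Z x m \<omega>)} \<in> sets (GW p)"
  using branching_sets[OF branching_locally_extinct, of x 0] by simp

section \<open>Partial extinction without global extinction is null\<close>

text \<open>The sets with arbitrarily good approximations from the past form a sigma-algebra
  containing the one-coordinate cylinders. For a countable union, continuity of the measure first
  reduces to a finite union.\<close>

lemma approximation_by_past:
  assumes "A \<in> sets (GW p)" "0 < e"
  shows "\<exists>n. \<exists>B\<in>sets (past p n). measure (GW p) (sym_diff A B) < e"
proof -
  have "sets (GW p) = sigma_sets UNIV {{\<omega>. \<omega> k \<in> X} | k X. X \<in> sets (litter p k)}"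
    using space_GW unfolding GW_def space_PiM by (subst sets_PiM_single) simp
  with assms(1) have A: "A \<in> sigma_sets UNIV {{\<omega>. \<omega> k \<in> X} | k X. X \<in> sets (litter p k)}" by simp
  define ap where "ap A \<longleftrightarrow> A \<in> sets (GW p) \<and>
    (\<forall>e>0. \<exists>n. \<exists>B\<in>sets (past p n). measure (GW p) (sym_diff A B) < e)" for A
  have ap_Un: "ap (A \<union> A')" if "ap A" "ap A'" for A A'
    unfolding ap_def
  proof (intro conjI allI impI)
    show "A \<union> A' \<in> sets (GW p)" using that by (auto simp: ap_def)
    fix e :: real assume "0 < e"
    then have "0 < e / 2" by simp
    with that obtain n B n' B' where B: "B \<in> sets (past p n)" "measure (GW p) (sym_diff A B) < e / 2"
      and B': "B' \<in> sets (past p n')" "measure (GW p) (sym_diff A' B') < e / 2"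
      unfolding ap_def by meson
    have "B \<in> sets (past p (max n n'))" "B' \<in> sets (past p (max n n'))"
      using B B' by (auto intro: sets_past_mono[rotated])
    then have 1: "B \<union> B' \<in> sets (past p (max n n'))" by blast
    have [measurable]: "A \<in> sets (GW p)" "A' \<in> sets (GW p)" "B \<in> sets (GW p)" "B' \<in> sets (GW p)"
      using that B B' sets_past_GW by (auto simp: ap_def)
    have "measure (GW p) (sym_diff (A \<union> A') (B \<union> B')) \<le> measure (GW p) (sym_diff A B \<union> sym_diff A' B')"
      by (rule GW.finite_measure_mono) auto
    also have "\<dots> \<le> measure (GW p) (sym_diff A B) + measure (GW p) (sym_diff A' B')"
      by (rule measure_Un_le) auto
    also have "\<dots> < e" using B B' by simp
    finally show "\<exists>n. \<exists>B\<in>sets (past p n). measure (GW p) (sym_diff (A \<union> A') B) < e" using 1 by blast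
  qed
  from A have "ap A"
  proof (induction rule: sigma_sets.induct)
    case (Basic A)
    then obtain m y i X where "A = {\<omega>. \<omega> (m, y, i) \<in> X}" by auto
    then have 1: "A \<in> sets (past p (Suc m))"
      using measurable_sets[OF coordinate_measurable_past[of m "Suc m" y i], of X] by (simp add: vimage_def)
    then show ?case unfolding ap_def using sets_past_GW[OF 1] by (intro conjI allI impI exI[of _ "Suc m"] bexI[OF _ 1]) auto
  next
    case Empty
    show ?case unfolding ap_def by (intro conjI allI impI exI[of _ 0] bexI[of _ "{}"]) auto
  next
    case (Compl A)
    show ?case unfolding ap_def
    proof (intro conjI allI impI)
      show "UNIV - A \<in> sets (GW p)" using Compl by (auto simp: ap_def)
      fix e :: real assume "0 < e"
      then obtain n B where B: "B \<in> sets (past p n)" "measure (GW p) (sym_diff A B) < e"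
        using Compl unfolding ap_def by blast
      have "sym_diff (UNIV - A) (UNIV - B) = sym_diff A B" by auto
      moreover have "UNIV - B \<in> sets (past p n)" using sets.compl_sets[OF B(1)] by simp
      ultimately show "\<exists>n. \<exists>B\<in>sets (past p n). measure (GW p) (sym_diff (UNIV - A) B) < e"
        using B by metis
    qed
  next
    case (Union a)
    have fin: "ap (\<Union>i<k. a i)" for k :: nat
    proof (induction k)
      case 0
      show ?case unfolding ap_def by (intro conjI allI impI exI[of _ 0] bexI[of _ "{}"]) auto
    next
      case (Suc k)
      show ?case using ap_Un[OF Union.IH[of k] Suc] by (simp add: lessThan_Suc)
    qed
    have a: "a i \<in> sets (GW p)" for i using Union.IH by (auto simp: ap_def)
    show ?case unfolding ap_def
    proof (intro conjI allI impI)
      show U: "(\<Union>i. a i) \<in> sets (GW p)" using a by blast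
      fix e :: real assume "0 < e"
      then have e: "0 < e / 2" by simp
      have "(\<lambda>k. measure (GW p) (\<Union>i<k. a i)) \<longlonglongrightarrow> measure (GW p) (\<Union>k. \<Union>i<k. a i)"
      proof (rule GW.finite_Lim_measure_incseq)
        show "incseq (\<lambda>k. \<Union>i<k. a i)"
          unfolding incseq_def by (intro allI impI UN_mono) auto
      qed (use a in auto)
      moreover have "(\<Union>k. \<Union>i<k. a i) = (\<Union>i. a i)" by auto
      ultimately have "(\<lambda>k. measure (GW p) (\<Union>i<k. a i)) \<longlonglongrightarrow> measure (GW p) (\<Union>i. a i)" by simp
      from LIMSEQ_D[OF this e] obtain k where
        "norm (measure (GW p) (\<Union>i<k. a i) - measure (GW p) (\<Union>i. a i)) < e / 2" by blast
      moreover have "measure (GW p) ((\<Union>i. a i) - (\<Union>i<k. a i)) =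
          measure (GW p) (\<Union>i. a i) - measure (GW p) (\<Union>i<k. a i)"
        by (rule GW.finite_measure_Diff) (use U a in auto)
      ultimately have k: "measure (GW p) ((\<Union>i. a i) - (\<Union>i<k. a i)) < e / 2"
        unfolding real_norm_def by linarith
      obtain n B where B: "B \<in> sets (past p n)" "measure (GW p) (sym_diff (\<Union>i<k. a i) B) < e / 2"
        using fin[of k] e unfolding ap_def by blast
      have [measurable]: "B \<in> sets (GW p)" using B sets_past_GW by blast
      have "measure (GW p) (sym_diff (\<Union>i. a i) B) \<le>
          measure (GW p) (((\<Union>i. a i) - (\<Union>i<k. a i)) \<union> sym_diff (\<Union>i<k. a i) B)"
        by (rule GW.finite_measure_mono) (use a in auto)
      also have "\<dots> \<le> measure (GW p) ((\<Union>i. a i) - (\<Union>i<k. a i)) + measure (GW p) (sym_diff (\<Union>i<k. a i) B)"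
        by (rule measure_Un_le) (use a in auto)
      also have "\<dots> < e" using k B by simp
      finally show "\<exists>n. \<exists>B\<in>sets (past p n). measure (GW p) (sym_diff (\<Union>i. a i) B) < e" using B by blast
    qed
  qed
  then show ?thesis using assms(2) by (auto simp: ap_def)
qed

text \<open>
  A form of Levy's zero-one law: conditionally on the past, partial extinction has probability at
  most \<open>c < 1\<close> as long as the population is not empty, so on global survival it must fail.
\<close>
lemma partial_extinction_prob_eq_global:
  assumes c: "\<And>y. partial_extinction_prob p y \<le> c" "c < 1"
  shows "partial_extinction_prob p x = global_extinction_prob p x"
proof -
  let ?r = "partial_extinction_prob p"
  have r: "?r \<in> UNIV \<rightarrow> {0..1}" by (simp add: partial_extinction_prob_eq)
  have c0: "0 \<le> c" using r c(1)[of x] by (auto simp: Pi_iff intro: order_trans)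
  define E where "E = {\<omega>. locally_extinct (\<lambda>m. Z x m \<omega>)}"
  define S where "S n = {\<omega>. Z x n \<omega> \<noteq> {#}}" for n
  define A where "A = {\<omega>\<in>E. \<forall>n. Z x n \<omega> \<noteq> {#}}"
  have [measurable]: "E \<in> sets (GW p)" "S n \<in> sets (GW p)" for n
    unfolding E_def S_def by (rule locally_extinct_sets sets_GW_Z)+
  have "A = E \<inter> (\<Inter>n. S n)" by (auto simp: A_def S_def)
  then have A [measurable]: "A \<in> sets (GW p)" by simp
  have "measure (GW p) A \<le> 0"
  proof (rule field_le_epsilon)
    fix d :: real assume "0 < d"
    \<comment> \<open>The estimate below gives
      \<open>measure (GW p) (E \<inter> S n) * (1 - c) \<le> 2 * e\<close>, so this choice leaves
      exactly \<open>d\<close> after division by \<open>1 - c\<close>.\<close>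
    define e where "e = d * (1 - c) / 2"
    have "0 < e" using \<open>0 < d\<close> c by (simp add: e_def)
    then obtain n B where B: "B \<in> sets (past p n)" and e: "measure (GW p) (sym_diff E B) < e"
      using approximation_by_past[of E e] by auto
    have [measurable]: "B \<in> sets (GW p)" using B by (rule sets_past_GW)
    have BS: "B \<inter> S n \<in> sets (past p n)" using B sets_past_Z[of "\<lambda>z. z \<noteq> {#}"] by (auto simp: S_def)
    \<comment> \<open>The event \<open>B\<close> of the past stands in for \<open>E\<close> while
      the branching property is applied at time \<open>n\<close>, and is then exchanged back; this
      bounds \<open>E \<inter> S n\<close> by \<open>c\<close> times itself up to errors in
      \<open>e\<close>.\<close>
    have "measure (GW p) (E \<inter> S n) \<le> measure (GW p) ((B \<inter> S n) \<inter> E \<union> sym_diff E B)"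
      by (rule GW.finite_measure_mono) auto
    also have "\<dots> \<le> measure (GW p) ((B \<inter> S n) \<inter> E) + measure (GW p) (sym_diff E B)"
      by (rule measure_Un_le) auto
    \<comment> \<open>Local extinction is unaffected by dropping the first \<open>n\<close>
      generations.\<close>
    also have "E = {\<omega>. locally_extinct (\<lambda>m. Z x (n + m) \<omega>)}"
      unfolding E_def locally_extinct_def
      by (subst eventually_sequentially_seg[of _ n, symmetric]) (simp add: add.commute)
    then have "measure (GW p) ((B \<inter> S n) \<inter> E) = (\<integral>\<omega>. indicator (B \<inter> S n) \<omega> * weight ?r (Z x n \<omega>) \<partial>GW p)"
      using branching_prob[OF branching_locally_extinct BS, of x] by (simp add: partial_extinction_prob_eq[abs_def])
    also have "\<dots> \<le> (\<integral>\<omega>. indicator (B \<inter> S n) \<omega> * c \<partial>GW p)"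
    proof (rule integral_mono)
      show "integrable (GW p) (\<lambda>\<omega>. indicator (B \<inter> S n) \<omega> * weight ?r (Z x n \<omega>))"
        by (rule integrable_weight[OF r]) simp
      show "integrable (GW p) (\<lambda>\<omega>. indicator (B \<inter> S n) \<omega> * c)"
        by (intro integrable_mult_left integrable_real_indicator) (auto simp: less_top[symmetric])
      fix \<omega>
      show "indicator (B \<inter> S n) \<omega> * weight ?r (Z x n \<omega>) \<le> indicator (B \<inter> S n) \<omega> * c"
      proof (cases "\<omega> \<in> S n")
        case True
        then obtain y where "y \<in># Z x n \<omega>" by (auto simp: S_def)
        from weight_le_member[OF r this] c(1)[of y] show ?thesis by (simp add: indicator_def)
      qed simp
    qed
    also have "\<dots> = measure (GW p) (B \<inter> S n) * c" by (rule integral_mult_prob) simp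
    also have "measure (GW p) (B \<inter> S n) \<le> measure (GW p) (E \<inter> S n) + e"
    proof -
      have "measure (GW p) (B \<inter> S n) \<le> measure (GW p) (E \<inter> S n \<union> sym_diff E B)"
        by (rule GW.finite_measure_mono) auto
      also have "\<dots> \<le> measure (GW p) (E \<inter> S n) + measure (GW p) (sym_diff E B)"
        by (rule measure_Un_le) auto
      finally show ?thesis using e by simp
    qed
    finally have "measure (GW p) (E \<inter> S n) \<le> (measure (GW p) (E \<inter> S n) + e) * c + e"
      using e c0 by (simp add: mult_right_mono)
    then have "measure (GW p) (E \<inter> S n) * (1 - c) \<le> e * c + e" by (simp add: algebra_simps)
    also have "\<dots> \<le> 2 * e" using c \<open>0 < e\<close> by simp
    also have "\<dots> = d * (1 - c)" by (simp add: e_def)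
    finally have "measure (GW p) (E \<inter> S n) * (1 - c) \<le> d * (1 - c)" .
    then have "measure (GW p) (E \<inter> S n) \<le> d" using c by simp
    moreover have "measure (GW p) A \<le> measure (GW p) (E \<inter> S n)"
      by (rule GW.finite_measure_mono) (auto simp: A_def S_def)
    ultimately show "measure (GW p) A \<le> 0 + d" by simp
  qed
  then have "measure (GW p) A = 0" by (simp add: measure_le_0_iff)
  moreover have "{\<omega>. \<exists>n. Z x n \<omega> = {#}} = E - A"
    unfolding A_def E_def locally_extinct_def eventually_sequentially
    by (auto, metis Z_empty_mono empty_iff set_mset_empty)
  moreover have "measure (GW p) (E - A) = measure (GW p) E - measure (GW p) A"
    by (rule GW.finite_measure_Diff) (auto simp: A_def)
  ultimately show ?thesis
    by (simp add: partial_extinction_prob_eq global_extinction_prob_eq E_def)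
qed

section \<open>Iterates of the generating function and minimality of global extinction\<close>

lemma partial_extinction_prob_bounds: "partial_extinction_prob p \<in> UNIV \<rightarrow> {0..1}"
  by (simp add: partial_extinction_prob_eq)

text \<open>Dropping generation 0 does not change local extinction; the branching property at time 1
  followed by the one-step identity yields the equation.\<close>

lemma partial_extinction_prob_fixed: "gen_fun p (partial_extinction_prob p) = partial_extinction_prob p"
proof
  fix x
  have "partial_extinction_prob p x = measure (GW p) (UNIV \<inter> {\<omega>. locally_extinct (\<lambda>m. Z x (1 + m) \<omega>)})"
    unfolding partial_extinction_prob_eq locally_extinct_def
    using eventually_sequentially_Suc[of "\<lambda>m. _ \<notin># Z x m _"] by (simp del: Z.simps)
  also have "\<dots> = (\<integral>\<omega>. indicator UNIV \<omega> * weight (partial_extinction_prob p) (Z x 1 \<omega>) \<partial>GW p)"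
    using branching_prob[OF branching_locally_extinct UNIV_past, of x 1]
    by (simp add: partial_extinction_prob_eq[abs_def] del: Z.simps)
  also have "\<dots> = (\<integral>\<omega>. indicator UNIV \<omega> * weight (gen_fun p (partial_extinction_prob p)) (Z x 0 \<omega>) \<partial>GW p)"
    using integral_weight_Suc[OF UNIV_past partial_extinction_prob_bounds, of x 0] by simp
  finally show "gen_fun p (partial_extinction_prob p) x = partial_extinction_prob p x" by simp
qed

text \<open>Iterates the one-step identity. For \<open>n = 0\<close> and \<open>B = UNIV\<close> it
  says that the generating function of generation \<open>k\<close> is the \<open>k\<close>-fold
  iterate.\<close>

lemma integral_weight_add:
  assumes "B \<in> sets (past p n)" "u \<in> UNIV \<rightarrow> {0..1}"
  shows "(\<integral>\<omega>. indicator B \<omega> * weight u (Z x (n + k) \<omega>) \<partial>GW p) =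
    (\<integral>\<omega>. indicator B \<omega> * weight ((gen_fun p ^^ k) u) (Z x n \<omega>) \<partial>GW p)"
  using assms(2)
proof (induction k arbitrary: u)
  case (Suc k)
  have "B \<in> sets (past p (n + k))" using assms(1) by (rule sets_past_mono[rotated]) simp
  from integral_weight_Suc[OF this Suc.prems, of x] Suc.IH[OF gen_fun_bounds[OF Suc.prems]]
  show ?case by (simp add: funpow_swap1 del: Z.simps)
qed simp

lemma gen_fun_funpow_bounds: "u \<in> UNIV \<rightarrow> {0..1} \<Longrightarrow> (gen_fun p ^^ k) u \<in> UNIV \<rightarrow> {0..1}"
  by (induction k) (simp_all add: gen_fun_bounds)

lemma integral_weight_Z:
  assumes "u \<in> UNIV \<rightarrow> {0..1}"
  shows "(\<integral>\<omega>. weight u (Z x n \<omega>) \<partial>GW p) = (gen_fun p ^^ n) u x"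
  using integral_weight_add[OF UNIV_past assms, of x 0 n] by simp

lemma integrable_weight_Z:
  "u \<in> UNIV \<rightarrow> {0..1} \<Longrightarrow> integrable (GW p) (\<lambda>\<omega>. weight u (Z x n \<omega>))"
  using integrable_weight[OF _ UNIV_GW, of u x n] by simp

lemma gen_fun_one: "gen_fun p (\<lambda>_. 1) = (\<lambda>_. 1)"
  by (rule ext) (subst gen_fun_eq_integral; simp)

text \<open>The monomial of \<open>s\<close> in \<open>Z x n\<close> has mean \<open>s x\<close> for
  every \<open>n\<close>, is nonnegative, and equals 1 on the empty population.\<close>

lemma global_extinction_prob_le_fixed:
  assumes s: "s \<in> UNIV \<rightarrow> {0..1}" "gen_fun p s = s"
  shows "global_extinction_prob p x \<le> s x"
  unfolding global_extinction_prob_eq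
proof (rule LIMSEQ_le_const2)
  have "(\<lambda>n. measure (GW p) {\<omega>. Z x n \<omega> = {#}}) \<longlonglongrightarrow> measure (GW p) (\<Union>n. {\<omega>. Z x n \<omega> = {#}})"
    by (rule GW.finite_Lim_measure_incseq) (use sets_GW_Z in \<open>auto simp: incseq_def simp del: Z.simps intro: Z_empty_mono\<close>)
  then show "(\<lambda>n. measure (GW p) {\<omega>. Z x n \<omega> = {#}}) \<longlonglongrightarrow> measure (GW p) {\<omega>. \<exists>n. Z x n \<omega> = {#}}"
    by (simp add: Collect_ex_eq)
  have "measure (GW p) {\<omega>. Z x n \<omega> = {#}} \<le> s x" for n
  proof -
    have "(gen_fun p ^^ n) s = s" by (induction n) (auto simp: s)
    then have "s x = (\<integral>\<omega>. weight s (Z x n \<omega>) \<partial>GW p)" using integral_weight_Z[OF s(1)] by simp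
    also have "\<dots> \<ge> (\<integral>\<omega>. indicator {\<omega>. Z x n \<omega> = {#}} \<omega> \<partial>GW p)"
    proof (rule integral_mono[OF _ integrable_weight_Z[OF s(1)]])
      show "integrable (GW p) (indicator {\<omega>. Z x n \<omega> = {#}} :: _ \<Rightarrow> real)"
        using sets_GW_Z by (intro integrable_real_indicator) (auto simp: less_top[symmetric])
    qed (use weight_bounds[OF s(1)] in \<open>auto simp: indicator_def simp del: Z.simps\<close>)
    finally show ?thesis by simp
  qed
  then show "\<exists>N. \<forall>n\<ge>N. measure (GW p) {\<omega>. Z x n \<omega> = {#}} \<le> s x" by blast
qed

section \<open>Growth of the second moment\<close>

text \<open>Turns an edge of the mean graph into a litter in the support: a type that is almost
  surely absent from the litter has mean zero.\<close>

lemma mean_pos_imp_child: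
  assumes "0 < mean p x y" shows "\<exists>j\<in>set_pmf (p x). y \<in># j"
proof (rule ccontr)
  assume "\<not> ?thesis"
  then have "AE j in litter p (0, x, 0). y \<notin># j" by (auto simp: AE_measure_pmf_iff)
  then have "AE \<omega> in PiM UNIV (litter p). y \<notin># \<omega> (0, x, 0)"
    by (intro AE_PiM_component) (auto simp: measure_pmf.prob_space_axioms)
  then have "AE \<omega> in GW p. count (Z x 1 \<omega>) y = 0" unfolding GW_def by (simp add: not_in_iff)
  then have "mean p x y = (\<integral>\<^sup>+\<omega>. 0 \<partial>GW p)"
    unfolding mean_def by (intro nn_integral_cong_AE) (auto simp del: Z.simps)
  then show False using assms by simp
qed

text \<open>The iterates are the second moments of the martingale at successive generations. The
  first step is nonnegativity of a variance, the others follow by monotonicity of the generating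
  function.\<close>

lemma fixed_point_square_increasing:
  assumes s: "s \<in> UNIV \<rightarrow> {0..1}" "gen_fun p s = s"
  shows "(gen_fun p ^^ k) (\<lambda>y. s y ^ 2) y \<le> (gen_fun p ^^ Suc k) (\<lambda>y. s y ^ 2) y"
proof (induction k arbitrary: y)
  case 0
  have s2: "(\<lambda>y. s y ^ 2) \<in> UNIV \<rightarrow> {0..1}" using s by (auto simp: Pi_iff power_le_one)
  have "(\<integral>j. weight s j \<partial>measure_pmf (p y)) ^ 2 \<le> (\<integral>j. weight s j ^ 2 \<partial>measure_pmf (p y))"
    using measure_pmf.variance_eq[of "p y" "weight s"]
      measure_pmf.variance_positive[of "p y" "weight s"]
      integrable_weight_pmf[OF s(1)] integrable_weight_pmf[OF s2]
    by (simp only: weight_power)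
  then show ?case
    using s by (simp add: gen_fun_eq_integral[OF s2] weight_power gen_fun_eq_integral[OF s(1), symmetric])
next
  case (Suc k)
  have s2: "(\<lambda>y. s y ^ 2) \<in> UNIV \<rightarrow> {0..1}" using s by (auto simp: Pi_iff power_le_one)
  show ?case
    using gen_fun_mono[OF gen_fun_funpow_bounds[OF s2] gen_fun_funpow_bounds[OF s2] Suc.IH] by simp
qed

text \<open>
  The left side is the square of the mean and the right side the second moment of \<open>s\<close> to the
  power \<open>Z\<^sub>k\<close> under \<open>P\<^sub>x\<close>. If that variance vanishes for all \<open>k\<close>, then it also vanishes for every
  descendant type, which makes \<open>s\<close> constant along paths of the mean graph.
\<close>
lemma fixed_point_nondegenerate:
  assumes irr: "irreducible_process p" and ns: "nonsingular p"
    and s: "s \<in> UNIV \<rightarrow> {0..1}" "gen_fun p s = s" "s \<noteq> (\<lambda>_. 1)" and pos: "0 < s x"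
  shows "\<exists>k. s x ^ 2 < (gen_fun p ^^ k) (\<lambda>y. s y ^ 2) x"
proof (rule ccontr)
  define t where "t k = (gen_fun p ^^ k) (\<lambda>y. s y ^ 2)" for k
  assume "\<not> ?thesis"
  then have le: "t k x \<le> s x ^ 2" for k by (auto simp: t_def not_less)
  have s2: "(\<lambda>y. s y ^ 2) \<in> UNIV \<rightarrow> {0..1}" using s by (auto simp: Pi_iff power_le_one)
  have t_bounds: "t k \<in> UNIV \<rightarrow> {0..1}" for k unfolding t_def by (rule gen_fun_funpow_bounds[OF s2])
  have t_Suc: "t (Suc k) y = (\<integral>j. weight (t k) j \<partial>measure_pmf (p y))" for k y
    using gen_fun_eq_integral[OF t_bounds[of k]] by (simp add: t_def)
  have t_mono: "t k y \<le> t (Suc k) y" for k y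
    unfolding t_def by (rule fixed_point_square_increasing[OF s(1,2)])
  have t_ge: "s y ^ 2 \<le> t k y" for k y
    using lift_Suc_mono_le[of "\<lambda>k. t k y" 0 k] t_mono by (simp add: t_def)
  \<comment> \<open>The property inherited by children: no variance at any generation, and a lower
    bound that keeps \<open>s\<close> positive.\<close>
  define P where "P y \<longleftrightarrow> s x \<le> s y \<and> (\<forall>k. t k y = s y ^ 2)" for y
  have Px: "P x" using le t_ge by (simp add: P_def order_antisym)
  have weight_litter: "weight s j = s y" if "P y" "j \<in> set_pmf (p y)" for y j
  proof -
    have "(\<integral>j. (weight s j - s y) ^ 2 \<partial>measure_pmf (p y)) = t 1 y - s y ^ 2"
      using measure_pmf.variance_eq[of "p y" "weight s"] integrable_weight_pmf[OF s(1)]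
        integrable_weight_pmf[OF s2] t_Suc[of 0 y] gen_fun_eq_integral[OF s(1), of y] s(2)
      by (simp add: weight_power t_def)
    also have "\<dots> = 0" using that by (simp add: P_def)
    finally have "AE j in measure_pmf (p y). (weight s j - s y) ^ 2 = 0"
    proof (subst (asm) integral_nonneg_eq_0_iff_AE)
      have "(weight s j - s y) ^ 2 \<le> 1" for j
      proof -
        have "\<bar>weight s j - s y\<bar> \<le> 1" using weight_bounds[OF s(1), of j] funcset_mem[OF s(1), of y]
          by (simp add: abs_le_iff)
        then show ?thesis by (simp add: abs_square_le_1)
      qed
      then show "integrable (measure_pmf (p y)) (\<lambda>j. (weight s j - s y) ^ 2)"
        by (intro measure_pmf.integrable_const_bound[where B = 1]) auto
    qed auto
    then show ?thesis using that by (auto simp: AE_measure_pmf_iff)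
  qed
  have child: "P z" if y: "P y" and j: "j \<in> set_pmf (p y)" "z \<in># j" for y j z
    unfolding P_def
  proof (intro conjI allI)
    have ws: "weight s j = s y" by (rule weight_litter[OF y j(1)])
    show "s x \<le> s z" using weight_le_member[OF s(1) j(2)] ws y by (simp add: P_def)
    fix k
    have diff: "0 \<le> weight (t k) j - weight (t 0) j" for j
      using weight_mono[where z = j and u = "t 0" and v = "t k"] t_ge by (simp add: t_def)
    have int: "integrable (measure_pmf (p y)) (weight (t k))" for k
      by (rule integrable_weight_pmf[OF t_bounds])
    \<comment> \<open>The integrand is nonnegative and its mean is
      \<open>t (Suc k) y - t 1 y\<close>, which vanishes by \<open>P y\<close>; hence it vanishes on
      the support.\<close>
    have "(\<integral>j. weight (t k) j - weight (t 0) j \<partial>measure_pmf (p y)) = 0"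
      using y t_Suc[of k y] t_Suc[of 0 y] int by (simp add: P_def)
    then have "AE j in measure_pmf (p y). weight (t k) j - weight (t 0) j = 0"
      by (subst (asm) integral_nonneg_eq_0_iff_AE) (use diff int in auto)
    then have eq: "weight (t k) j = weight s j ^ 2"
      using j by (auto simp: AE_measure_pmf_iff t_def weight_power)
    \<comment> \<open>The factor of the siblings \<open>r\<close> is nonzero because
      \<open>s y\<close> is positive, so it can be cancelled to isolate the coordinate
      \<open>z\<close>.\<close>
    obtain r where r: "j = add_mset z r" using j(2) by (metis mset_add)
    have "0 < s y" using y pos by (simp add: P_def)
    moreover have "s z * weight s r = s y" using ws r by simp
    ultimately have "weight s r \<noteq> 0" by (metis less_irrefl mult_zero_right)
    then have wr: "0 < weight s r ^ 2" by simp
    have "weight s r ^ 2 \<le> weight (t k) r"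
      using weight_mono[where z = r and u = "t 0" and v = "t k"] t_ge by (simp add: t_def weight_power)
    then have "t k z * weight s r ^ 2 \<le> t k z * weight (t k) r"
      using t_bounds[of k] by (intro mult_left_mono) (auto simp: Pi_iff)
    also have "\<dots> = s z ^ 2 * weight s r ^ 2" using eq r by (simp add: power_mult_distrib)
    finally have "t k z \<le> s z ^ 2" using wr by simp
    then show "t k z = s z ^ 2" using t_ge by (simp add: order_antisym)
  qed
  have P: "P y" for y
  proof -
    have "(x, y) \<in> {(u, v). mean p u v > 0}\<^sup>*" using irr by (simp add: irreducible_process_def)
    then show ?thesis
      by (induction rule: rtrancl_induct) (use Px child mean_pos_imp_child in blast)+
  qed
  \<comment> \<open>Along an edge \<open>s\<close> cannot decrease, since it equals the monomial of
    a litter containing the child. A path back to \<open>x\<close> gives the bound opposite to the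
    one in \<open>P\<close>.\<close>
  have s_const: "s y = s x" for y
  proof (rule antisym)
    have "(y, x) \<in> {(u, v). mean p u v > 0}\<^sup>*" using irr by (simp add: irreducible_process_def)
    then show "s y \<le> s x"
    proof (induction rule: rtrancl_induct)
      case (step u v)
      then obtain j where "j \<in> set_pmf (p u)" "v \<in># j" using mean_pos_imp_child by blast
      with weight_litter[OF P] weight_le_member[OF s(1)] have "s u \<le> s v" by metis
      with step show ?case by simp
    qed simp
  qed (use P in \<open>simp add: P_def\<close>)
  have "s x \<noteq> 1" using s(3) s_const by fastforce
  then have less: "s x < 1" using s(1) by (auto simp: Pi_iff less_le)
  \<comment> \<open>For a constant strictly between 0 and 1 the equation
    \<open>s x ^ size j = s x\<close> leaves only one child, against nonsingularity.\<close>
  have "size j = 1" if "j \<in> set_pmf (p y)" for j y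
  proof -
    have "s x ^ size j = weight s j"
      unfolding weight_const[symmetric]
      by (intro arg_cong[where f = prod_mset] image_mset_cong s_const[symmetric])
    also have "\<dots> = s x ^ 1" using weight_litter[OF P that] s_const[of y] by simp
    finally show ?thesis using power_inject_exp'[OF less_imp_neq[OF less] pos] by blast
  qed
  then have "measure_pmf.prob (p y) {j. size j = 1} = 1" for y
    by (intro measure_pmf.prob_eq_1[THEN iffD2]) (auto simp: AE_measure_pmf_iff)
  then show False using ns by (simp add: nonsingular_def)
qed

text \<open>
  Whenever \<open>y\<close> is present and the martingale exceeds \<open>e\<close>, its second moment grows over the next
  \<open>k\<close> generations by a fixed amount, while the total growth is bounded by \<open>k\<close>.
\<close>
lemma summable_visits:
  assumes s: "s \<in> UNIV \<rightarrow> {0..1}" "gen_fun p s = s"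
    and y: "s y ^ 2 < (gen_fun p ^^ k) (\<lambda>y. s y ^ 2) y" and e: "0 < e"
  shows "summable (\<lambda>n. measure (GW p) {\<omega>. y \<in># Z x n \<omega> \<and> e < weight s (Z x n \<omega>)})"
proof -
  define t where "t k = (gen_fun p ^^ k) (\<lambda>y. s y ^ 2)" for k
  define d where "d = t k y - s y ^ 2"
  have d: "0 < d" using y by (simp add: d_def t_def)
  let ?A = "\<lambda>n. {\<omega>. y \<in># Z x n \<omega> \<and> e < weight s (Z x n \<omega>)}"
  have s2: "(\<lambda>y. s y ^ 2) \<in> UNIV \<rightarrow> {0..1}" using s by (auto simp: Pi_iff power_le_one)
  have t_bounds: "t k \<in> UNIV \<rightarrow> {0..1}" for k unfolding t_def by (rule gen_fun_funpow_bounds[OF s2])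
  have t_mono: "t k y \<le> t (Suc k) y" for k y
    unfolding t_def by (rule fixed_point_square_increasing[OF s])
  have t_ge: "s y ^ 2 \<le> t k y" for k y
    using lift_Suc_mono_le[of "\<lambda>k. t k y" 0 k] t_mono by (simp add: t_def)
  have A [measurable]: "?A n \<in> sets (GW p)" for n
    by (rule sets_GW_Z)
  \<comment> \<open>With one individual \<open>y\<close> split off, the gain \<open>d\<close> is
    multiplied by the squared monomial of the others, which is at least \<open>e ^ 2\<close> because
    \<open>s y \<le> 1\<close>.\<close>
  have pointwise: "of_bool (y \<in># z \<and> e < weight s z) * (e ^ 2 * d) \<le> weight (t k) z - weight (t 0) z" for z
  proof (cases "y \<in># z \<and> e < weight s z")
    case False
    then show ?thesis
      using weight_mono[where z = z and u = "t 0" and v = "t k"] t_ge by (auto simp: t_def)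
  next
    case True
    then obtain r where r: "z = add_mset y r" by (metis mset_add)
    have r0: "0 \<le> weight s r" "weight s r \<le> 1" "s y \<le> 1" "0 \<le> s y"
      using weight_bounds[OF s(1), of r] s(1) by (auto simp: Pi_iff)
    have "e \<le> weight s r" using True r r0 mult_left_le_one_le[of "weight s r" "s y"] by simp
    then have "e ^ 2 \<le> weight s r ^ 2" using e by (intro power_mono) auto
    then have "e ^ 2 * d \<le> weight s r ^ 2 * d" using d by (intro mult_right_mono) auto
    also have "\<dots> = t k y * weight s r ^ 2 - s y ^ 2 * weight s r ^ 2" by (simp add: d_def algebra_simps)
    also have "t k y * weight s r ^ 2 \<le> t k y * weight (t k) r"
      using weight_mono[where z = r and u = "t 0" and v = "t k"] t_ge t_bounds[of k]
      by (intro mult_left_mono) (auto simp: t_def weight_power Pi_iff)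
    finally show ?thesis using True r by (simp add: t_def weight_power power_mult_distrib)
  qed
  have step: "measure (GW p) (?A n) * (e ^ 2 * d) \<le> t (n + k) x - t n x" for n
  proof -
    have "measure (GW p) (?A n) * (e ^ 2 * d) = (\<integral>\<omega>. indicator (?A n) \<omega> * (e ^ 2 * d) \<partial>GW p)"
      by (rule integral_mult_prob[symmetric]) simp
    also have "\<dots> \<le> (\<integral>\<omega>. weight (t k) (Z x n \<omega>) - weight (t 0) (Z x n \<omega>) \<partial>GW p)"
    proof (rule integral_mono)
      show "integrable (GW p) (\<lambda>\<omega>. indicator (?A n) \<omega> * (e ^ 2 * d))"
        using A by (intro integrable_mult_left integrable_real_indicator) (auto simp: less_top[symmetric])
      show "integrable (GW p) (\<lambda>\<omega>. weight (t k) (Z x n \<omega>) - weight (t 0) (Z x n \<omega>))"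
        by (intro Bochner_Integration.integrable_diff integrable_weight_Z t_bounds)
      show "indicator (?A n) \<omega> * (e ^ 2 * d) \<le> weight (t k) (Z x n \<omega>) - weight (t 0) (Z x n \<omega>)" for \<omega>
        using pointwise[of "Z x n \<omega>"] by (simp add: indicator_def)
    qed
    also have "\<dots> = (\<integral>\<omega>. weight (t k) (Z x n \<omega>) \<partial>GW p) - (\<integral>\<omega>. weight (t 0) (Z x n \<omega>) \<partial>GW p)"
      by (intro Bochner_Integration.integral_diff integrable_weight_Z t_bounds)
    also have "\<dots> = t (n + k) x - t n x"
      unfolding integral_weight_Z[OF t_bounds] by (simp add: t_def funpow_add)
    finally show ?thesis .
  qed
  \<comment> \<open>The increment over \<open>k\<close> generations splits into \<open>k\<close>
    one-step increments. Each telescopes in \<open>n\<close> to a difference of numbers in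
    \<open>[0,1]\<close>.\<close>
  have tele: "(\<Sum>n<N. t (n + k) x - t n x) \<le> real k" for N k
  proof (induction k)
    case (Suc k)
    have "(\<Sum>n<N. t (n + Suc k) x - t n x) =
        (\<Sum>n<N. t (Suc n + k) x - t (n + k) x) + (\<Sum>n<N. t (n + k) x - t n x)"
      by (simp add: sum.distrib[symmetric])
    also have "(\<Sum>n<N. t (Suc n + k) x - t (n + k) x) = t (N + k) x - t k x"
      using sum_lessThan_telescope[of "\<lambda>n. t (n + k) x" N] by simp
    also have "\<dots> \<le> 1" using t_bounds[of "N + k"] t_bounds[of k] by (auto simp: Pi_iff intro: order_trans[OF diff_left_mono])
    finally show ?case using Suc by simp
  qed simp
  have "summable (\<lambda>n. measure (GW p) (?A n) * (e ^ 2 * d))"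
  proof (rule summableI_nonneg_bounded)
    show "(\<Sum>n<N. measure (GW p) (?A n) * (e ^ 2 * d)) \<le> real k" for N
      using sum_mono[of "{..<N}", OF step] tele by (meson order_trans)
  qed (use d in simp)
  then show ?thesis using d e by (simp add: mult.commute[of _ "e ^ 2 * d"] summable_cmult_iff)
qed

section \<open>Upper bound for fixed points and conclusion\<close>

lemma fixed_point_le_partial:
  assumes irr: "irreducible_process p" and ns: "nonsingular p"
    and s: "s \<in> UNIV \<rightarrow> {0..1}" "gen_fun p s = s" "s \<noteq> (\<lambda>_. 1)"
  shows "s x \<le> partial_extinction_prob p x"
proof (rule field_le_epsilon)
  fix e :: real assume e: "0 < e"
  define C where "C n = {\<omega>. \<forall>m\<le>n. e < weight s (Z x m \<omega>)}" for n
  have C: "C n \<in> sets (past p n)" for n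
  proof -
    have "{\<omega>. e < weight s (Z x m \<omega>)} \<in> sets (past p n)" if "m \<le> n" for m
      by (rule sets_past_mono[OF that sets_past_Z])
    then have "(\<Inter>m\<in>{..n}. {\<omega>. e < weight s (Z x m \<omega>)}) \<in> sets (past p n)"
      by (intro sets.countable_INT'') auto
    moreover have "(\<Inter>m\<in>{..n}. {\<omega>. e < weight s (Z x m \<omega>)}) = C n" by (auto simp: C_def)
    ultimately show ?thesis by simp
  qed
  have C' [measurable]: "C n \<in> sets (GW p)" for n using C by (rule sets_past_GW)
  have int: "integrable (GW p) (\<lambda>\<omega>. indicator B \<omega> * weight s (Z x n \<omega>))" if "B \<in> sets (GW p)" for B n
    by (rule integrable_weight[OF s(1) that])
  have intc: "integrable (GW p) (\<lambda>\<omega>. indicator B \<omega> * (c::real))" if "B \<in> sets (GW p)" for B c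
    using that by (intro integrable_mult_left integrable_real_indicator) (auto simp: less_top[symmetric])
  \<comment> \<open>optional stopping at the first time the martingale is at most \<open>e\<close>\<close>
  have stop: "s x \<le> (\<integral>\<omega>. indicator (C n) \<omega> * weight s (Z x n \<omega>) \<partial>GW p) + e * (1 - measure (GW p) (C n))" for n
  proof (induction n)
    case 0
    show ?case
    proof (cases "e < s x")
      case True
      then have "C 0 = UNIV" by (simp add: C_def)
      then show ?thesis by simp
    next
      case False
      then have "C 0 = {}" by (simp add: C_def)
      then show ?thesis using False by simp
    qed
  next
    case (Suc n)
    have sub: "C (Suc n) \<subseteq> C n" by (auto simp: C_def)
    have D: "C n - C (Suc n) \<in> sets (GW p)" by simp
    have "(\<integral>\<omega>. indicator (C n) \<omega> * weight s (Z x n \<omega>) \<partial>GW p) =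
        (\<integral>\<omega>. indicator (C n) \<omega> * weight s (Z x (Suc n) \<omega>) \<partial>GW p)"
      using integral_weight_Suc[OF C s(1), of n x] s(2) by simp
    also have "\<dots> \<le> (\<integral>\<omega>. indicator (C (Suc n)) \<omega> * weight s (Z x (Suc n) \<omega>) +
        indicator (C n - C (Suc n)) \<omega> * e \<partial>GW p)"
    proof (rule integral_mono)
      show "indicator (C n) \<omega> * weight s (Z x (Suc n) \<omega>) \<le>
        indicator (C (Suc n)) \<omega> * weight s (Z x (Suc n) \<omega>) + indicator (C n - C (Suc n)) \<omega> * e" for \<omega>
        \<comment> \<open>On \<open>C n - C (Suc n)\<close> the martingale is at most
          \<open>e\<close> for the first time at generation \<open>Suc n\<close>, whence the bound
          by \<open>e\<close> there.\<close>
        using sub by (auto simp: indicator_def C_def le_Suc_eq not_less simp del: Z.simps)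
    qed (intro Bochner_Integration.integrable_add int intc C' D)+
    also have "\<dots> = (\<integral>\<omega>. indicator (C (Suc n)) \<omega> * weight s (Z x (Suc n) \<omega>) \<partial>GW p) +
        measure (GW p) (C n - C (Suc n)) * e"
      by (subst Bochner_Integration.integral_add[OF int[OF C'] intc[OF D]]) (simp add: integral_mult_prob[OF D] del: Z.simps)
    also have "measure (GW p) (C n - C (Suc n)) = measure (GW p) (C n) - measure (GW p) (C (Suc n))"
      by (rule GW.finite_measure_Diff) (use sub in auto)
    finally show ?case using Suc by (simp add: algebra_simps del: Z.simps)
  qed
  have "s x \<le> measure (GW p) (C n) + e" for n
  proof -
    have "(\<integral>\<omega>. indicator (C n) \<omega> * weight s (Z x n \<omega>) \<partial>GW p) \<le> (\<integral>\<omega>. indicator (C n) \<omega> * 1 \<partial>GW p)"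
      by (rule integral_mono[OF int intc])
        (use weight_le_1[OF s(1)] in \<open>auto simp: indicator_def\<close>)
    also have "\<dots> = measure (GW p) (C n)" by simp
    finally show ?thesis
      using stop[of n] mult_nonneg_nonneg[OF less_imp_le[OF e] measure_nonneg[of "GW p" "C n"]]
      by (simp add: algebra_simps)
  qed
  moreover have "(\<lambda>n. measure (GW p) (C n) + e) \<longlonglongrightarrow> measure (GW p) (\<Inter>n. C n) + e"
  proof (intro tendsto_add tendsto_const GW.finite_Lim_measure_decseq)
    show "range C \<subseteq> sets (GW p)" using C' by blast
    show "decseq C" by (auto simp: decseq_def C_def intro: order_trans)
  qed
  ultimately have "s x \<le> measure (GW p) (\<Inter>n. C n) + e" by (intro LIMSEQ_le_const) auto
  also have "measure (GW p) (\<Inter>n. C n) \<le> partial_extinction_prob p x"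
    unfolding partial_extinction_prob_eq
  proof (rule GW.finite_measure_mono_AE[OF _ locally_extinct_sets])
    have "AE \<omega> in GW p. \<forall>\<^sub>F n in sequentially. \<not> (y \<in># Z x n \<omega> \<and> e < weight s (Z x n \<omega>))" for y
    \<comment> \<open>If \<open>s y = 0\<close>, presence of \<open>y\<close> makes the monomial
      zero, so no visit above \<open>e\<close> occurs; otherwise the visits are summable and
      Borel-Cantelli applies.\<close>
    proof (cases "s y = 0")
      case True
      have "weight s z \<le> e" if "y \<in># z" for z
        using weight_le_member[OF s(1) that] True e by simp
      then show ?thesis by (auto simp: not_less)
    next
      case False
      then have "0 < s y" using s(1) by (auto simp: Pi_iff less_le)
      with fixed_point_nondegenerate[OF irr ns s] obtain k
        where "s y ^ 2 < (gen_fun p ^^ k) (\<lambda>y. s y ^ 2) y" by blast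
      from summable_visits[OF s(1,2) this e, of x]
      have "AE \<omega> in GW p. \<forall>\<^sub>F n in sequentially. \<omega> \<in> space (GW p) - {\<omega>. y \<in># Z x n \<omega> \<and> e < weight s (Z x n \<omega>)}"
        by (intro borel_cantelli_AE1 sets_GW_Z) (auto simp: less_top[symmetric])
      then show ?thesis by simp
    qed
    then have "AE \<omega> in GW p. \<forall>y. \<forall>\<^sub>F n in sequentially. \<not> (y \<in># Z x n \<omega> \<and> e < weight s (Z x n \<omega>))"
      by (subst AE_all_countable) blast
    then show "AE \<omega> in GW p. \<omega> \<in> (\<Inter>n. C n) \<longrightarrow> \<omega> \<in> {\<omega>. locally_extinct (\<lambda>m. Z x m \<omega>)}"
    proof eventually_elim
      case (elim \<omega>)
      show ?case
      proof
        assume "\<omega> \<in> (\<Inter>n. C n)"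
        then have "e < weight s (Z x n \<omega>)" for n by (auto simp: C_def)
        with elim show "\<omega> \<in> {\<omega>. locally_extinct (\<lambda>m. Z x m \<omega>)}" by (simp add: locally_extinct_def)
      qed
    qed
  qed
  finally show "s x \<le> partial_extinction_prob p x + e" by simp
qed

end

theorem corollary3:
  fixes p :: "('a::countable) offspring"
  assumes "irreducible_process p"
    and "(SUP x. partial_extinction_prob p x) < 1"
  shows "partial_extinction_prob p = global_extinction_prob p \<and>
    (nonsingular p \<longrightarrow> fixed_points p = {global_extinction_prob p, (\<lambda>_. 1)})"
proof
  let ?q = "global_extinction_prob p"
  \<comment> \<open>A real supremum bounds its family only when the range is bounded above.\<close>
  have "bdd_above (range (partial_extinction_prob p))"
    using partial_extinction_prob_bounds[of p] by (intro bdd_aboveI[of _ 1]) (auto simp: Pi_iff)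
  then have "partial_extinction_prob p x \<le> (SUP x. partial_extinction_prob p x)" for x
    by (rule cSUP_upper[rotated]) simp
  from partial_extinction_prob_eq_global[OF this assms(2)]
  show eq: "partial_extinction_prob p = ?q" by blast
  show "nonsingular p \<longrightarrow> fixed_points p = {?q, (\<lambda>_. 1)}"
  proof (intro impI set_eqI iffI)
    fix s assume ns: "nonsingular p" and "s \<in> fixed_points p"
    then have s: "s \<in> UNIV \<rightarrow> {0..1}" "gen_fun p s = s"
      unfolding fixed_points_def by (blast, metis (mono_tags, lifting) mem_Collect_eq)
    show "s \<in> {?q, (\<lambda>_. 1)}"
    proof (cases "s = (\<lambda>_. 1)")
      case False
      \<comment> \<open>Minimality of \<open>?q\<close> from below and partial extinction from
        above, which coincide.\<close>
      have "s x = ?q x" for x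
        using fixed_point_le_partial[OF assms(1) ns s False, of x] global_extinction_prob_le_fixed[OF s, of x]
        by (simp add: eq)
      then show ?thesis by auto
    qed simp
  next
    fix s assume "s \<in> {?q, (\<lambda>_. 1)}"
    then show "s \<in> fixed_points p"
      using partial_extinction_prob_fixed[of p] partial_extinction_prob_bounds[of p] gen_fun_one[of p]
      by (auto simp: fixed_points_def eq)
  qed
qed

end
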